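(* Let $G$ be a finite group. Then: (1) $\Gamma(G)$ is connected, and $\Gamma(G)$ is a complete graph if and only if $G$ is trivial or $G\cong\mathbb{Z}_p$ for some prime $p$. (2) $\Gamma(G)$ is a path graph if and only if $G\cong\mathbb{Z}_{p^k}$ for some prime $p$ and some positive integer $k$. (3) $\Gamma(G)$ is a cycle graph if and only if $G\cong\mathbb{Z}_{pq}$ for some distinct primes $p$ and $q$. (4) $\Gamma(G)$ is a star graph if and only if $G$ is isomorphic to $\mathbb{Z}_{p^2}$ for some prime $p$, or to $Q_8$, or $G$ is a group in which every non-identity element has prime order.
   Context: For a finite group $G$, the cyclic subgroup graph $\Gamma(G)$ is the simple undirected graph whose vertex set is $C(G)$, the set of all cyclic subgroups of $G$ (including the trivial subgroup $\{e\}$), and in which two distinct vertices are adjacent if and only if one of them, $H_1$, is contained in the other, $H_2$, and there is no subgroup $K$ of $G$ with $H_1<K<H_2$ (strict inclusions). $\mathbb{Z}_n$ denotes the cyclic group of order $n$ and $Q_8$ the quaternion group of order $8$. Conventions: a path graph has at least one edge; a star graph is a graph $K_{1,n}$ with $n\ge 0$ (so a single vertex and a single edge count as stars); a cycle graph has at least three vertices. *)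

theory Defs
  imports
    "HOL-Computational_Algebra.Primes"
    "HOL-Algebra.Elementary_Groups"
    "HOL-Algebra.Multiplicative_Group"
    "Graph_Theory.Graph_Theory"
begin

definition cyclic_subgroups :: "('a, 'b) monoid_scheme \<Rightarrow> 'a set set" where
  "cyclic_subgroups G = {H. subgroup H G \<and> cyclic_group (G\<lparr>carrier := H\<rparr>)}"

text \<open>The intermediate subgroup \<open>K\<close> ranges over all subgroups of \<open>G\<close>, not only the cyclic ones.\<close>

definition subgroup_covered_by :: "('a, 'b) monoid_scheme \<Rightarrow> 'a set \<Rightarrow> 'a set \<Rightarrow> bool" where
  "subgroup_covered_by G H1 H2 \<longleftrightarrow>
     H1 \<subset> H2 \<and> \<not> (\<exists>K. subgroup K G \<and> H1 \<subset> K \<and> K \<subset> H2)"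

text \<open>Undirected simple graphs are represented, as in the library, by symmetric loop-free digraphs
  without parallel arcs: an edge between \<open>u\<close> and \<open>v\<close> is the pair of arcs \<open>(u, v)\<close> and \<open>(v, u)\<close>.\<close>

definition cyclic_subgroup_graph ::
    "('a, 'b) monoid_scheme \<Rightarrow> ('a set, 'a set \<times> 'a set) pre_digraph" where
  "cyclic_subgroup_graph G = with_proj
     \<lparr> pverts = cyclic_subgroups G,
       parcs = {(H1, H2). H1 \<in> cyclic_subgroups G \<and> H2 \<in> cyclic_subgroups G \<and>
                  (subgroup_covered_by G H1 H2 \<or> subgroup_covered_by G H2 H1)} \<rparr>"

text \<open>The library constants used below are parametrised by the numbers of vertices and already
  require the argument to be a finite simple graph. In a star the part with \<open>n\<close> vertices may be
  empty, so the one-vertex graph is a star.\<close>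

definition complete_graph :: "('a, 'b) pre_digraph \<Rightarrow> bool" where
  "complete_graph D \<longleftrightarrow> (\<exists>n. complete_digraph n D)"

definition star_graph :: "('a, 'b) pre_digraph \<Rightarrow> bool" where
  "star_graph D \<longleftrightarrow> (\<exists>n. complete_bipartite_digraph 1 n D)"

definition path_graph :: "('a, 'b) pre_digraph \<Rightarrow> bool" where
  "path_graph D \<longleftrightarrow> graph D \<and>
     (\<exists>vs. distinct vs \<and> 2 \<le> length vs \<and> verts D = set vs \<and>
        arcs_ends D = {(vs ! i, vs ! j) | i j.
          i < length vs \<and> j < length vs \<and> (j = Suc i \<or> i = Suc j)})"

definition cycle_graph :: "('a, 'b) pre_digraph \<Rightarrow> bool" where
  "cycle_graph D \<longleftrightarrow> graph D \<and>
     (\<exists>vs. distinct vs \<and> 3 \<le> length vs \<and> verts D = set vs \<and>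
        arcs_ends D = {(vs ! i, vs ! j) | i j.
          i < length vs \<and> j < length vs \<and>
          (j = Suc i mod length vs \<or> i = Suc j mod length vs)})"

text \<open>The quadruple \<open>(a, b, c, d)\<close> stands for the Hamilton quaternion \<open>a + b i + c j + d k\<close>;
  \<open>Q8\<close> is \<open>{1, -1, i, -i, j, -j, k, -k}\<close> under quaternion multiplication.\<close>

type_synonym int_quaternion = "int \<times> int \<times> int \<times> int"

fun quaternion_mult :: "int_quaternion \<Rightarrow> int_quaternion \<Rightarrow> int_quaternion" where
  "quaternion_mult (a1, b1, c1, d1) (a2, b2, c2, d2) =
    (a1 * a2 - b1 * b2 - c1 * c2 - d1 * d2,
     a1 * b2 + b1 * a2 + c1 * d2 - d1 * c2,
     a1 * c2 - b1 * d2 + c1 * a2 + d1 * b2,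
     a1 * d2 + b1 * c2 - c1 * b2 + d1 * a2)"

definition Q8 :: "int_quaternion monoid" where
  "Q8 = \<lparr> carrier = {(1, 0, 0, 0), (-1, 0, 0, 0), (0, 1, 0, 0), (0, -1, 0, 0),
                    (0, 0, 1, 0), (0, 0, -1, 0), (0, 0, 0, 1), (0, 0, 0, -1)},
         monoid.mult = quaternion_mult,
         one = (1, 0, 0, 0) \<rparr>"

lemma group_Q8: "group Q8"
proof (rule groupI)
  fix x y z assume "x \<in> carrier Q8" "y \<in> carrier Q8" "z \<in> carrier Q8"
  show "x \<otimes>\<^bsub>Q8\<^esub> y \<otimes>\<^bsub>Q8\<^esub> z = x \<otimes>\<^bsub>Q8\<^esub> (y \<otimes>\<^bsub>Q8\<^esub> z)"
    by (cases x; cases y; cases z) (simp add: Q8_def algebra_simps)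
qed (auto simp: Q8_def)

lemma graph_cyclic_subgroup_graph:
  assumes "finite (carrier G)"
  shows "graph (cyclic_subgroup_graph G)"
proof -
  have "cyclic_subgroups G \<subseteq> Pow (carrier G)"
    by (auto simp: cyclic_subgroups_def dest: subgroup.subset)
  then have fin: "finite (cyclic_subgroups G)"
    using assms by (meson finite_Pow_iff finite_subset)
  let ?P = "\<lparr> pverts = cyclic_subgroups G,
       parcs = {(H1, H2). H1 \<in> cyclic_subgroups G \<and> H2 \<in> cyclic_subgroups G \<and>
                  (subgroup_covered_by G H1 H2 \<or> subgroup_covered_by G H2 H1)} \<rparr>"
  have "finite (parcs ?P)"
    by (rule finite_subset[of _ "cyclic_subgroups G \<times> cyclic_subgroups G"]) (auto simp: fin)
  then interpret pair_graph ?P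
    by unfold_locales
       (auto simp: fin symmetric_def subgroup_covered_by_def intro!: symI)
  show ?thesis
    unfolding cyclic_subgroup_graph_def by unfold_locales
qed

end

theory Submission
  imports Defs "HOL-Algebra.Sylow"
begin

text \<open>
  Everything rests on the subgroup structure of finite cyclic groups: a cyclic group of order \<open>n\<close> has
  exactly one subgroup of each order dividing \<open>n\<close>. Consequently a subgroup is covered by a cyclic
  subgroup exactly if its index in it is prime (\<open>covered_card\<close>, \<open>covered_if_prime_index\<close>), the
  neighbours of the trivial subgroup are the subgroups of prime order, and every cyclic subgroup is
  reached from the trivial one by a chain of covers. This gives connectedness. In a complete graph
  every nontrivial cyclic subgroup has prime order, and no two such subgroups are adjacent, so there
  is at most one.

  In a path or a cycle every vertex has at most two neighbours; let this be the case.
  If the trivial subgroup has two neighbours \<open>P\<close> and \<open>Q\<close>, these are the only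
  subgroups of prime order. Conjugation permutes them, hence each normalizes the other, they commute,
  and their orders differ, since otherwise the product of two generators would generate a third
  subgroup of prime order. So \<open>P Q\<close> is cyclic of order \<open>p q\<close> and \<open>1, P, PQ, Q\<close> is a 4-cycle; no
  further edge can leave it, and by connectedness it is the whole graph. This is a cycle and not a
  path. If the trivial subgroup has one neighbour, every cyclic subgroup has at most
  one upper cover, because a nontrivial one also has a lower cover; then all cyclic subgroups lie in
  a single maximal one, which is the whole group and has only one prime divisor.

  For stars, consider the centre. If it is the trivial subgroup, all nontrivial elements have prime
  order. Otherwise the centre is a subgroup \<open>H\<close> of prime order \<open>p\<close>, and the \<open>p\<close>-th power of every
  element outside \<open>H\<close> is a nontrivial element of \<open>H\<close>; this is the locale \<open>prime_core\<close>. There \<open>H\<close> is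
  central, since it is cyclic and consists of powers of each element outside \<open>H\<close>. For odd \<open>p\<close> the group is \<open>H\<close> or
  cyclic of order \<open>p\<^sup>2\<close>: if \<open>x\<close> outside \<open>H\<close> does not generate the group, counting fixed cosets gives
  \<open>g\<close> outside the group \<open>C\<close> generated by \<open>x\<close> that normalizes \<open>C\<close>. The commutator of \<open>g\<close>
  with elements of \<open>C\<close> lies in \<open>H\<close>, so \<open>(u g)\<^sup>p = u\<^sup>p g\<^sup>p\<close> for \<open>u\<close> in \<open>C\<close>, and choosing \<open>u\<close> with
  \<open>u\<^sup>p = g\<^sup>-\<^sup>p\<close> puts \<open>u g\<close> into \<open>H\<close> and \<open>g\<close> into \<open>C\<close>, a contradiction. For \<open>p = 2\<close> a direct
  computation leaves, besides \<open>H\<close> and the cyclic group of order 4, only the quaternion group.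
\<close>

section \<open>Conjugation and powers in groups\<close>

lemma (in group) inv_cancel_left: "x \<in> carrier G \<Longrightarrow> y \<in> carrier G \<Longrightarrow> inv y \<otimes> (y \<otimes> x) = x"
  by (simp flip: m_assoc)

lemma (in group) conj_cancel: "x \<in> carrier G \<Longrightarrow> y \<in> carrier G \<Longrightarrow> inv y \<otimes> (y \<otimes> x \<otimes> inv y) \<otimes> y = x"
  by (simp add: m_assoc inv_cancel_left)

lemma (in group) conj_pow:
  assumes "x \<in> carrier G" "y \<in> carrier G"
  shows "(y \<otimes> x \<otimes> inv y) [^] (n::nat) = y \<otimes> x [^] n \<otimes> inv y"
proof (induction n)
  case (Suc n)
  have "(y \<otimes> x [^] n \<otimes> inv y) \<otimes> (y \<otimes> x \<otimes> inv y) = y \<otimes> (x [^] n \<otimes> x) \<otimes> inv y"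
    using assms by (simp add: m_assoc inv_cancel_left)
  then show ?case using Suc by simp
qed (use assms in simp)

lemma (in group) ord_conj:
  assumes "x \<in> carrier G" "y \<in> carrier G"
  shows "ord (y \<otimes> x \<otimes> inv y) = ord x"
proof -
  have "y \<otimes> z \<otimes> inv y = \<one> \<longleftrightarrow> z = \<one>" if "z \<in> carrier G" for z
  proof
    assume "y \<otimes> z \<otimes> inv y = \<one>"
    then show "z = \<one>" using conj_cancel[OF that assms(2)] assms(2) by simp
  qed (use assms(2) in simp)
  then have "(y \<otimes> x \<otimes> inv y) [^] n = \<one> \<longleftrightarrow> ord x dvd n" for n :: nat
    using assms by (simp add: conj_pow pow_eq_id)
  then show ?thesis using assms by (subst ord_unique) auto
qed

text \<open>The power of a product of two elements whose commutator \<open>e\<close> commutes with both. The exponent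
  of \<open>e\<close> is \<open>n (n - 1) / 2\<close>.\<close>

lemma (in group) pow_mult_twisted:
  fixes n :: nat
  assumes c: "u \<in> carrier G" "v \<in> carrier G" "e \<in> carrier G"
    and e: "e \<otimes> u = u \<otimes> e" "e \<otimes> v = v \<otimes> e" and vu: "v \<otimes> u = e \<otimes> (u \<otimes> v)"
  shows "(u \<otimes> v) [^] n = e [^] (\<Sum>i<n. i) \<otimes> (u [^] n \<otimes> v [^] n)"
proof (induction n)
  case (Suc n)
  have ep: "e [^] (k::nat) \<otimes> w = w \<otimes> e [^] k" if "e \<otimes> w = w \<otimes> e" "w \<in> carrier G" for k w
    using that c by (induction k) (simp_all add: m_assoc, metis m_assoc nat_pow_closed)
  have vn: "v [^] k \<otimes> u = e [^] k \<otimes> (u \<otimes> v [^] k)" for k :: nat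
  proof (induction k)
    case (Suc k)
    have "v [^] Suc k \<otimes> u = v [^] k \<otimes> (e \<otimes> (u \<otimes> v))"
      using c vu by (simp add: m_assoc)
    also have "\<dots> = v [^] k \<otimes> (u \<otimes> (e \<otimes> v))"
      using c e by (metis m_assoc)
    also have "\<dots> = (v [^] k \<otimes> u) \<otimes> (v \<otimes> e)"
      using c e by (simp add: m_assoc)
    also have "\<dots> = e [^] k \<otimes> (u \<otimes> (v [^] k \<otimes> v) \<otimes> e)"
      unfolding Suc using c by (simp add: m_assoc)
    also have "u \<otimes> (v [^] k \<otimes> v) \<otimes> e = e \<otimes> (u \<otimes> (v [^] k \<otimes> v))"
    proof -
      have "v [^] j \<otimes> e = e \<otimes> v [^] j" for j :: nat
      proof (induction j)
        case (Suc j)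
        have "v [^] Suc j \<otimes> e = (v [^] j \<otimes> e) \<otimes> v" using c e(2) by (simp add: m_assoc)
        then show ?case using Suc c by (simp add: m_assoc)
      qed (use c in simp)
      from this[of "Suc k"] show ?thesis using c e(1) by (simp add: m_assoc[symmetric]) (simp add: m_assoc)
    qed
    finally show ?case using c by (simp add: m_assoc)
  qed (use c in simp)
  let ?T = "\<Sum>i<n. i"
  have "(u \<otimes> v) [^] Suc n = e [^] ?T \<otimes> (u [^] n \<otimes> (v [^] n \<otimes> u) \<otimes> v)"
    using Suc c by (simp add: m_assoc)
  also have "u [^] n \<otimes> (v [^] n \<otimes> u) \<otimes> v = (u [^] n \<otimes> e [^] n) \<otimes> (u \<otimes> v [^] n \<otimes> v)"
    unfolding vn using c by (simp add: m_assoc)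
  also have "u [^] n \<otimes> e [^] n = e [^] n \<otimes> u [^] n"
  proof -
    have "e \<otimes> u [^] j = u [^] j \<otimes> e" for j :: nat
    proof (induction j)
      case (Suc j)
      have "e \<otimes> u [^] Suc j = (e \<otimes> u [^] j) \<otimes> u" using c by (simp add: m_assoc)
      also have "\<dots> = u [^] j \<otimes> (e \<otimes> u)" using c Suc by (simp add: m_assoc)
      finally show ?case using c e(1) by (simp add: m_assoc)
    qed (use c in simp)
    then show ?thesis using ep c by simp
  qed
  also have "e [^] ?T \<otimes> (e [^] n \<otimes> u [^] n \<otimes> (u \<otimes> v [^] n \<otimes> v)) =
      (e [^] ?T \<otimes> e [^] n) \<otimes> (u [^] Suc n \<otimes> v [^] Suc n)"
    using c by (simp add: m_assoc)
  also have "e [^] ?T \<otimes> e [^] n = e [^] (\<Sum>i<Suc n. i)"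
    using c by (simp add: nat_pow_mult)
  finally show ?case .
qed (use c in simp)

section \<open>Auxiliary facts on naturals and permutations of prime order\<close>

lemma prime_power_if_unique_prime_divisor:
  fixes n p :: nat
  assumes "0 < n" "Factorial_Ring.prime p" "\<And>r. Factorial_Ring.prime r \<Longrightarrow> r dvd n \<Longrightarrow> r = p"
  obtains k where "n = p ^ k"
proof -
  obtain m where m: "n = p ^ multiplicity p n * m" "\<not> p dvd m"
    using multiplicity_decompose'[of n p] assms(1,2) by (metis less_numeral_extra(3) not_prime_unit)
  have "m = 1"
  proof (rule ccontr)
    assume "m \<noteq> 1"
    then obtain r where "Factorial_Ring.prime r" "r dvd m" using prime_factor_nat by blast
    moreover then have "r = p" using assms(3) m(1) by (metis dvd_mult)
    ultimately show False using m(2) by blast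
  qed
  then show ?thesis using that m(1) by simp
qed

text \<open>A self-map whose \<open>p\<close>-th iterate is the identity is a permutation; its orbits on the points it
  moves all have exactly \<open>p\<close> elements.\<close>

lemma prime_dvd_card_moved_points:
  fixes f :: "'b \<Rightarrow> 'b"
  assumes A: "finite A" and f: "\<And>a. a \<in> A \<Longrightarrow> f a \<in> A" and p: "Factorial_Ring.prime p"
    and per: "\<And>a. a \<in> A \<Longrightarrow> (f ^^ p) a = a"
  shows "p dvd card {a \<in> A. f a \<noteq> a}"
proof -
  let ?B = "{a \<in> A. f a \<noteq> a}"
  define orb where "orb a = range (\<lambda>i. (f ^^ i) a)" for a
  have p0: "0 < p" using p prime_gt_0_nat by blast
  have fA: "(f ^^ i) a \<in> A" if "a \<in> A" for a i
    using that f by (induction i) auto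
  have mult: "(f ^^ (m * k)) a = a" if "(f ^^ m) a = a" for a m k
    using that by (induction k) (auto simp: funpow_add)
  have orbit_returns: "(f ^^ (p - i mod p)) ((f ^^ i) a) = a" if "a \<in> A" for a i
  proof -
    have "i mod p < p" using p0 by simp
    then have "p - i mod p + i = p + p * (i div p)"
      using mult_div_mod_eq[of p i] by linarith
    then have e: "p - i mod p + i = p * Suc (i div p)" by simp
    have "(f ^^ (p - i mod p)) ((f ^^ i) a) = (f ^^ (p * Suc (i div p))) a"
      by (subst e[symmetric]) (simp add: funpow_add)
    then show ?thesis using mult[OF per[OF that], of "Suc (i div p)"] by simp
  qed
  have orb_eq: "orb ((f ^^ i) a) = orb a" if a: "a \<in> A" for a i
  proof -
    have sub: "orb ((f ^^ k) b) \<subseteq> orb b" for k b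
      unfolding orb_def by (auto simp flip: funpow_add simp: image_iff)
        (metis comp_apply funpow_add)
    show ?thesis
      using sub[of i a] sub[of "p - i mod p" "(f ^^ i) a"] orbit_returns[OF a, of i] by simp
  qed
  have orb_card: "card (orb a) = p" if a: "a \<in> A" "f a \<noteq> a" for a
  proof -
    have "orb a = (\<lambda>i. (f ^^ i) a) ` {..<p}"
    proof (intro equalityI subsetI)
      fix b assume "b \<in> orb a"
      then obtain i where b: "b = (f ^^ i) a" by (auto simp: orb_def)
      have "i = i mod p + p * (i div p)" by simp
      then have "(f ^^ i) a = (f ^^ (i mod p)) ((f ^^ (p * (i div p))) a)"
        by (metis comp_apply funpow_add)
      then have "b = (f ^^ (i mod p)) a" using b mult[OF per[OF a(1)]] by simp
      then show "b \<in> (\<lambda>i. (f ^^ i) a) ` {..<p}" using p0 by auto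
    qed (auto simp: orb_def)
    moreover have lt: "(f ^^ i) a \<noteq> (f ^^ j) a" if ij: "i < j" "j < p" for i j
    proof
      assume eq: "(f ^^ i) a = (f ^^ j) a"
      \<comment> \<open>If the orbit closes after \<open>m < p\<close> steps, then Bezout for \<open>m\<close> and \<open>p\<close> makes \<open>a\<close> fixed.\<close>
      let ?m = "j - i"
      have "(f ^^ ?m) a = (f ^^ ?m) ((f ^^ (p - i mod p)) ((f ^^ i) a))"
        using orbit_returns[OF a(1)] by simp
      also have "\<dots> = (f ^^ (p - i mod p)) ((f ^^ j) a)"
      proof -
        have "?m + (p - i mod p) + i = (p - i mod p) + j" using ij by simp
        then show ?thesis by (metis comp_apply funpow_add)
      qed
      also have "\<dots> = a" using orbit_returns[OF a(1)] eq by metis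
      finally have m: "(f ^^ ?m) a = a" .
      obtain d x y where d: "d dvd ?m" "d dvd p" "?m * x = p * y + d"
        using bezout_add_strong_nat[of ?m p] ij by auto
      have "d \<noteq> p" using d(1) ij nat_dvd_not_less by (metis diff_le_self le_less_trans less_imp_diff_less zero_less_diff)
      then have "?m * x = Suc (p * y)" using d(2,3) p by (auto simp: prime_nat_iff)
      then have "f a = a"
        using mult[OF m, of x] mult[OF per[OF a(1)], of y] by simp
      with a(2) show False by simp
    qed
    ultimately show ?thesis
      by (metis (no_types, lifting) card_image card_lessThan inj_onI lessThan_iff linorder_neqE_nat)
  qed
  have self: "a \<in> orb a" for a
    unfolding orb_def by (metis funpow_0 rangeI)
  have orb_sub: "orb a \<subseteq> ?B" if a: "a \<in> A" "f a \<noteq> a" for a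
  proof
    fix b assume "b \<in> orb a"
    then obtain i where b: "b = (f ^^ i) a" by (auto simp: orb_def)
    have "f b \<noteq> b"
    proof
      assume "f b = b"
      then have "(f ^^ k) b = b" for k by (induction k) auto
      then have "a = b" using orbit_returns[OF a(1), of i] b by simp
      with \<open>f b = b\<close> a(2) show False by simp
    qed
    then show "b \<in> ?B" using fA[OF a(1)] b by simp
  qed
  have un: "\<Union>(orb ` ?B) = ?B" using orb_sub self by blast
  have "p * card (orb ` ?B) = card (\<Union>(orb ` ?B))"
  proof (rule card_partition)
    show "c1 \<inter> c2 = {}" if c: "c1 \<in> orb ` ?B" "c2 \<in> orb ` ?B" "c1 \<noteq> c2" for c1 c2
    proof (rule ccontr)
      assume "c1 \<inter> c2 \<noteq> {}"
      then obtain b where b: "b \<in> c1" "b \<in> c2" by blast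
      obtain a1 a2 where a: "a1 \<in> A" "a2 \<in> A" and eq: "c1 = orb a1" "c2 = orb a2" using c by auto
      obtain i1 where "b = (f ^^ i1) a1" using b(1) unfolding eq orb_def by blast
      then have "orb b = c1" using orb_eq[OF a(1), of i1] eq(1) by simp
      obtain i2 where "b = (f ^^ i2) a2" using b(2) unfolding eq orb_def by blast
      then have "orb b = c2" using orb_eq[OF a(2), of i2] eq(2) by simp
      with \<open>orb b = c1\<close> show False using c(3) by simp
    qed
  next
    show "finite (orb ` ?B)" using A by simp
    show "finite (\<Union>(orb ` ?B))" unfolding un using A by simp
    show "card c = p" if "c \<in> orb ` ?B" for c using orb_card that by blast
  qed
  then show ?thesis unfolding un by (rule dvdI[OF sym])
qed

lemma exists_second_fixed_point:
  fixes f :: "'b \<Rightarrow> 'b"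
  assumes A: "finite A" and f: "\<And>a. a \<in> A \<Longrightarrow> f a \<in> A" and p: "Factorial_Ring.prime p"
    and per: "\<And>a. a \<in> A \<Longrightarrow> (f ^^ p) a = a" and dvd: "p dvd card A" and b: "b \<in> A" "f b = b"
  shows "\<exists>a\<in>A. f a = a \<and> a \<noteq> b"
proof (rule ccontr)
  assume "\<not> ?thesis"
  then have only: "A - {a \<in> A. f a \<noteq> a} = {b}" using b by blast
  have "card (A - {a \<in> A. f a \<noteq> a}) = card A - card {a \<in> A. f a \<noteq> a}"
    using A by (intro card_Diff_subset) auto
  moreover have "card (A - {a \<in> A. f a \<noteq> a}) = 1" unfolding only by simp
  moreover have "p dvd card A - card {a \<in> A. f a \<noteq> a}"
    using dvd prime_dvd_card_moved_points[OF A f p per] by (rule dvd_diff_nat)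
  ultimately have "p dvd 1" by simp
  then show False using p by simp
qed

section \<open>Subgroups of finite cyclic groups\<close>

text \<open>A group with finitely many elements.\<close>

locale finite_group = group +
  assumes fin: "finite (carrier G)"
begin

lemma ord_pos: "x \<in> carrier G \<Longrightarrow> 0 < ord x"
  using ord_ge_1[OF fin] by (metis less_le_trans zero_less_one)

lemma generate_eq_pow: "x \<in> carrier G \<Longrightarrow> generate G {x} = range (\<lambda>k::nat. x [^] k)"
  using generate_pow_on_finite_carrier[OF fin] by (auto simp: image_def)

lemma subgroup_generate: "x \<in> carrier G \<Longrightarrow> subgroup (generate G {x}) G"
  by (simp add: generate_is_subgroup)

lemma generate_self: "x \<in> generate G {x}"
  by (simp add: generate.incl)

lemma finite_subgroup: "subgroup H G \<Longrightarrow> finite H"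
  using fin subgroup.subset finite_subset by blast

lemma card_subgroup_pos: "subgroup H G \<Longrightarrow> 0 < card H"
  using subgroup.finite_imp_card_positive fin by blast

lemma generate_le: "subgroup H G \<Longrightarrow> x \<in> H \<Longrightarrow> generate G {x} \<subseteq> H"
  by (simp add: generate_subgroup_incl)

lemma subgroup_pow: "subgroup H G \<Longrightarrow> x \<in> H \<Longrightarrow> x [^] (k::nat) \<in> H"
  by (induction k) (auto simp: subgroup.one_closed subgroup.m_closed)

lemma cyclic_subgroups_eq: "cyclic_subgroups G = (\<lambda>x. generate G {x}) ` carrier G"
proof -
  have "cyclic_group (G\<lparr>carrier := H\<rparr>) \<longleftrightarrow> (\<exists>x\<in>H. H = generate G {x})" if H: "subgroup H G" for H
  proof -
    interpret H: group "G\<lparr>carrier := H\<rparr>"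
      using H by (rule subgroup_imp_group)
    have "range (\<lambda>n::int. x [^]\<^bsub>G\<lparr>carrier := H\<rparr>\<^esub> n) = generate G {x}" if "x \<in> H" for x
    proof -
      have "range (\<lambda>n::int. x [^]\<^bsub>G\<lparr>carrier := H\<rparr>\<^esub> n) = range (\<lambda>n::int. x [^] n)"
        using int_pow_consistent[OF H that] by simp
      then show ?thesis
        using generate_pow subgroup.mem_carrier[OF H that] by (auto simp: image_def)
    qed
    then show ?thesis
      using H.cyclic_group by simp
  qed
  then have "cyclic_subgroups G = {H. subgroup H G \<and> (\<exists>x\<in>H. H = generate G {x})}"
    unfolding cyclic_subgroups_def by auto
  also have "\<dots> = (\<lambda>x. generate G {x}) ` carrier G"
    by (auto simp: image_def subgroup_generate dest: subgroup.mem_carrier intro: generate_self)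
  finally show ?thesis .
qed

lemma cyclic_subgroupI: "x \<in> carrier G \<Longrightarrow> generate G {x} \<in> cyclic_subgroups G"
  by (simp add: cyclic_subgroups_eq)

lemma cyclic_subgroupE:
  assumes "H \<in> cyclic_subgroups G"
  obtains x where "x \<in> carrier G" "H = generate G {x}" "ord x = card H"
  using assms generate_pow_card by (auto simp: cyclic_subgroups_eq)

lemma cyclic_subgroup_subgroup: "H \<in> cyclic_subgroups G \<Longrightarrow> subgroup H G"
  by (simp add: cyclic_subgroups_def)

lemma generate_one: "generate G {\<one>} = {\<one>}"
  by (simp add: generate_eq_pow image_def)

lemma trivial_cyclic_subgroup: "{\<one>} \<in> cyclic_subgroups G"
  using cyclic_subgroupI[OF one_closed] generate_one by simp

lemma finite_cyclic_subgroups: "finite (cyclic_subgroups G)"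
  by (simp add: cyclic_subgroups_eq fin)

lemma subgroup_card_dvd:
  assumes "subgroup K G" "subgroup H G" "K \<subseteq> H"
  shows "card K dvd card H"
proof -
  interpret H: group "G\<lparr>carrier := H\<rparr>"
    using assms(2) by (rule subgroup_imp_group)
  have "subgroup K (G\<lparr>carrier := H\<rparr>)"
    using assms subgroup_incl by blast
  from H.lagrange[OF this] have "card (rcosets\<^bsub>G\<lparr>carrier := H\<rparr>\<^esub> K) * card K = card H"
    by (simp add: order_def)
  then show ?thesis by (metis dvd_triv_right)
qed

lemma ord_dvd_card: "subgroup H G \<Longrightarrow> x \<in> H \<Longrightarrow> ord x dvd card H"
  by (metis generate_le generate_pow_card subgroup.mem_carrier subgroup_card_dvd subgroup_generate)

lemma subgroup_pow_card: "subgroup H G \<Longrightarrow> x \<in> H \<Longrightarrow> x [^] card H = \<one>"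
  using ord_dvd_card[of H x] pow_eq_id[OF subgroup.mem_carrier[of H G x]] by simp

lemma subgroup_trivial_iff: "subgroup H G \<Longrightarrow> H = {\<one>} \<longleftrightarrow> card H = 1"
  by (metis card_1_singletonE is_singletonI is_singleton_altdef singletonD subgroup.one_closed)

lemma subgroup_eqI: "subgroup H G \<Longrightarrow> K \<subseteq> H \<Longrightarrow> card H \<le> card K \<Longrightarrow> K = H"
  by (rule card_seteq[OF finite_subgroup])

lemma prime_subgroup_generate:
  assumes "subgroup H G" "Factorial_Ring.prime (card H)" "x \<in> H" "x \<noteq> \<one>"
  shows "generate G {x} = H" and "ord x = card H"
proof -
  have x: "x \<in> carrier G" using assms(1,3) by (rule subgroup.mem_carrier)
  show "ord x = card H"
    using ord_dvd_card[OF assms(1,3)] assms(2,4) ord_eq_1[OF x]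
    by (metis One_nat_def prime_nat_iff)
  then show "generate G {x} = H"
    using generate_le[OF assms(1,3)] subgroup_eqI[OF assms(1)] generate_pow_card[OF x] by simp
qed

text \<open>For a divisor \<open>d\<close> of the order of \<open>x\<close>, the solutions of \<open>y\<^sup>d = 1\<close> among the powers of \<open>x\<close> are
  generated by a power of \<open>x\<close>, and there are \<open>d\<close> of them.\<close>

lemma generate_pow_roots:
  assumes x: "x \<in> carrier G" and d: "d dvd ord x"
  shows "generate G {x [^] (ord x div d)} = {y \<in> generate G {x}. y [^] d = \<one>}"
    and "card (generate G {x [^] (ord x div d)}) = d"
proof -
  let ?m = "ord x div d"
  have m: "ord x = ?m * d" and d0: "0 < d" and m0: "0 < ?m"
    using d ord_pos[OF x] by (auto intro: Nat.gr0I simp: dvd_div_eq_0_iff)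
  show "generate G {x [^] ?m} = {y \<in> generate G {x}. y [^] d = \<one>}"
  proof (intro equalityI subsetI)
    fix y assume "y \<in> generate G {x [^] ?m}"
    then obtain k where "y = (x [^] ?m) [^] (k::nat)"
      using x by (auto simp: generate_eq_pow)
    then have y: "y = x [^] (?m * k)" using x by (simp add: nat_pow_pow)
    have "y [^] d = \<one>"
      unfolding y nat_pow_pow[OF x] pow_eq_id[OF x] by (subst m) simp
    then show "y \<in> {y \<in> generate G {x}. y [^] d = \<one>}"
      using y x by (auto simp: generate_eq_pow)
  next
    fix y assume "y \<in> {y \<in> generate G {x}. y [^] d = \<one>}"
    then obtain k :: nat where y: "y = x [^] k" and "x [^] (k * d) = \<one>"
      using x by (auto simp: generate_eq_pow nat_pow_pow)
    then have "?m * d dvd k * d" using pow_eq_id[OF x] m by simp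
    then have "?m dvd k" using d0 by simp
    then obtain j where "k = ?m * j" ..
    then have "y = (x [^] ?m) [^] j" using y x by (simp add: nat_pow_pow)
    then show "y \<in> generate G {x [^] ?m}" using x by (auto simp: generate_eq_pow)
  qed
  have "ord (x [^] ?m) = d"
    using ord_pow[OF x, of ?m] m m0 by (metis dvd_triv_left nonzero_mult_div_cancel_left not_gr_zero)
  then show "card (generate G {x [^] ?m}) = d"
    using generate_pow_card[of "x [^] ?m"] x by simp
qed

text \<open>A subgroup of a cyclic group is determined by its order \<open>d\<close>: it consists of \<open>d\<close>-th roots of
  the identity, of which there are only \<open>d\<close>.\<close>

lemma subgroup_of_cyclic:
  assumes x: "x \<in> carrier G" and K: "subgroup K G" "K \<subseteq> generate G {x}"
  shows "K = generate G {x [^] (ord x div card K)}"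
proof (rule subgroup_eqI)
  have d: "card K dvd ord x"
    using subgroup_card_dvd[OF K(1) subgroup_generate[OF x] K(2)] generate_pow_card[OF x] by simp
  show "K \<subseteq> generate G {x [^] (ord x div card K)}"
    using K subgroup_pow_card generate_pow_roots(1)[OF x d] by auto
  show "card (generate G {x [^] (ord x div card K)}) \<le> card K"
    using generate_pow_roots(2)[OF x d] by simp
qed (use x in \<open>simp add: subgroup_generate\<close>)

lemma cyclic_intermediate:
  assumes V: "V \<in> cyclic_subgroups G" and K: "subgroup K G" "K \<subseteq> V"
    and e: "card K dvd e" "e dvd card V"
  obtains U where "U \<in> cyclic_subgroups G" "K \<subseteq> U" "U \<subseteq> V" "card U = e"
proof -
  obtain x where x: "x \<in> carrier G" "V = generate G {x}" "ord x = card V"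
    using V by (rule cyclic_subgroupE)
  let ?U = "generate G {x [^] (ord x div e)}"
  have U: "?U = {y \<in> V. y [^] e = \<one>}" "card ?U = e"
    using generate_pow_roots[OF x(1), of e] e x by auto
  have "y [^] e = \<one>" if "y \<in> K" for y
    using subgroup_pow_card[OF K(1) that] e(1) pow_eq_id[OF subgroup.mem_carrier[OF K(1) that]]
    by (meson dvd_trans)
  then show ?thesis
    using that[OF cyclic_subgroupI[of "x [^] (ord x div e)"]] U K x(1) by auto
qed

lemma cyclic_subgroup_of_order:
  assumes "V \<in> cyclic_subgroups G" "q dvd card V"
  obtains U where "U \<in> cyclic_subgroups G" "U \<subseteq> V" "card U = q"
  using cyclic_intermediate[OF assms(1) triv_subgroup _ _ assms(2)]
    cyclic_subgroup_subgroup[OF assms(1)] subgroup.one_closed by auto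

lemma covered_if_prime_index:
  assumes "subgroup H G" "subgroup V G" "H \<subseteq> V" "card V = q * card H" "Factorial_Ring.prime q"
  shows "subgroup_covered_by G H V"
  unfolding subgroup_covered_by_def
proof (intro conjI notI)
  have H0: "0 < card H" using card_subgroup_pos[OF assms(1)] .
  have q1: "1 < q" using assms(5) prime_gt_1_nat by blast
  have "card H \<noteq> card V" using H0 q1 assms(4) by simp
  then show "H \<subset> V" using assms(3) by auto
  assume "\<exists>K. subgroup K G \<and> H \<subset> K \<and> K \<subset> V"
  then obtain K where K: "subgroup K G" "H \<subset> K" "K \<subset> V" by blast
  obtain a where a: "card K = card H * a"
    using subgroup_card_dvd[OF assms(1) K(1)] K(2) by auto
  obtain b where b: "card V = card K * b"
    using subgroup_card_dvd[OF K(1) assms(2)] K(3) by auto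
  have "q = a * b" using a b assms(4) H0 by auto
  then have "a = 1 \<or> b = 1" using assms(5) prime_product by blast
  then have "card K = card H \<or> card V = card K" using a b by auto
  then show False
    using K finite_subgroup[OF K(1)] finite_subgroup[OF assms(2)]
    by (metis psubset_card_mono less_irrefl)
qed

text \<open>Between a subgroup \<open>K\<close> and a cyclic subgroup \<open>V\<close> properly containing it lies a cyclic cover of
  \<open>K\<close>, possibly \<open>V\<close> itself.\<close>

lemma cyclic_upper_cover_below:
  assumes V: "V \<in> cyclic_subgroups G" and K: "subgroup K G" "K \<subset> V"
  obtains U q where "U \<in> cyclic_subgroups G" "U \<subseteq> V" "subgroup_covered_by G K U"
    "card U = q * card K" "Factorial_Ring.prime q"
proof -
  have sV: "subgroup V G" using V by (rule cyclic_subgroup_subgroup)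
  obtain m where m: "card V = card K * m"
    using subgroup_card_dvd[OF K(1) sV] K(2) by auto
  have "card K < card V" using psubset_card_mono[OF finite_subgroup[OF sV] K(2)] .
  then have "m \<noteq> 1" using m by auto
  then obtain q where q: "Factorial_Ring.prime q" "q dvd m" using prime_factor_nat by blast
  have "q * card K dvd card V" using q(2) m by (simp add: mult.commute)
  then obtain U where U: "U \<in> cyclic_subgroups G" "K \<subseteq> U" "U \<subseteq> V" "card U = q * card K"
    using cyclic_intermediate[OF V K(1), of "q * card K"] K(2) by auto
  with q that covered_if_prime_index[OF K(1) cyclic_subgroup_subgroup[OF U(1)]] show ?thesis by blast
qed

text \<open>Conversely to \<open>covered_if_prime_index\<close>, a cyclic subgroup covers only subgroups of prime index.\<close>

lemma covered_card:
  assumes "V \<in> cyclic_subgroups G" "subgroup K G" "subgroup_covered_by G K V"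
  obtains q where "Factorial_Ring.prime q" "card V = q * card K"
proof -
  have "K \<subset> V" using assms(3) by (simp add: subgroup_covered_by_def)
  then obtain U q where U: "U \<in> cyclic_subgroups G" "U \<subseteq> V" "subgroup_covered_by G K U"
    "card U = q * card K" "Factorial_Ring.prime q"
    using cyclic_upper_cover_below[OF assms(1,2)] by metis
  have "U = V"
    using U assms(3) cyclic_subgroup_subgroup[OF U(1)] unfolding subgroup_covered_by_def by blast
  with U that show ?thesis by blast
qed

lemma cyclic_lower_cover:
  assumes V: "V \<in> cyclic_subgroups G" and q: "Factorial_Ring.prime q" "q dvd card V"
  obtains K where "K \<in> cyclic_subgroups G" "K \<subseteq> V" "card V = q * card K" "subgroup_covered_by G K V"
proof -
  have sV: "subgroup V G" using V by (rule cyclic_subgroup_subgroup)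
  obtain e where e: "card V = q * e" using q(2) by auto
  then have "e dvd card V" by simp
  then obtain K where K: "K \<in> cyclic_subgroups G" "K \<subseteq> V" "card K = e"
    using cyclic_subgroup_of_order[OF V] by metis
  with e q that covered_if_prime_index[OF cyclic_subgroup_subgroup[OF K(1)] sV] show ?thesis by blast
qed

lemma nontrivial_prime_dvd:
  assumes "subgroup V G" "V \<noteq> {\<one>}"
  obtains q where "Factorial_Ring.prime q" "q dvd card V"
  using prime_factor_nat subgroup_trivial_iff[OF assms(1)] assms(2) by metis

section \<open>Adjacency and connectedness\<close>

text \<open>Adjacency in the cyclic subgroup graph.\<close>

abbreviation adj :: "'a set \<Rightarrow> 'a set \<Rightarrow> bool" where
  "adj H K \<equiv> (H, K) \<in> arcs_ends (cyclic_subgroup_graph G)"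

lemma verts_eq: "verts (cyclic_subgroup_graph G) = cyclic_subgroups G"
  by (simp add: cyclic_subgroup_graph_def)

lemma adj_iff: "adj H K \<longleftrightarrow> H \<in> cyclic_subgroups G \<and> K \<in> cyclic_subgroups G \<and>
    (subgroup_covered_by G H K \<or> subgroup_covered_by G K H)"
  by (simp add: cyclic_subgroup_graph_def)

lemma adj_sym: "adj H K \<Longrightarrow> adj K H"
  by (auto simp: adj_iff)

lemma adj_trivial_iff:
  "adj {\<one>} H \<longleftrightarrow> H \<in> cyclic_subgroups G \<and> Factorial_Ring.prime (card H)"
proof
  assume "adj {\<one>} H"
  then have H: "H \<in> cyclic_subgroups G"
    and c: "subgroup_covered_by G {\<one>} H \<or> subgroup_covered_by G H {\<one>}"
    by (auto simp: adj_iff)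
  have "\<one> \<in> H" by (rule subgroup.one_closed[OF cyclic_subgroup_subgroup[OF H]])
  with c have "subgroup_covered_by G {\<one>} H" by (auto simp: subgroup_covered_by_def)
  from covered_card[OF H triv_subgroup this] show "H \<in> cyclic_subgroups G \<and> Factorial_Ring.prime (card H)"
    using H by auto
next
  assume H: "H \<in> cyclic_subgroups G \<and> Factorial_Ring.prime (card H)"
  then have "subgroup H G" "{\<one>} \<subseteq> H"
    using cyclic_subgroup_subgroup subgroup.one_closed by auto
  then have "subgroup_covered_by G {\<one>} H"
    using covered_if_prime_index[OF triv_subgroup, of H "card H"] H by simp
  then show "adj {\<one>} H" using H trivial_cyclic_subgroup by (simp add: adj_iff)
qed

text \<open>Every cyclic subgroup is reached from the trivial subgroup by a chain of covers through cyclic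
  subgroups.\<close>

lemma cyclic_subgroup_cover_induct [consumes 1, case_names trivial cover]:
  assumes H: "H \<in> cyclic_subgroups G" and triv: "P {\<one>}"
    and step: "\<And>K U. K \<in> cyclic_subgroups G \<Longrightarrow> U \<in> cyclic_subgroups G \<Longrightarrow>
      subgroup_covered_by G K U \<Longrightarrow> P K \<Longrightarrow> P U"
  shows "P H"
  using H
proof (induction "card H" arbitrary: H rule: less_induct)
  case less
  have sH: "subgroup H G" using less.prems by (rule cyclic_subgroup_subgroup)
  show ?case
  proof (cases "H = {\<one>}")
    case False
    then obtain q where "Factorial_Ring.prime q" "q dvd card H"
      using nontrivial_prime_dvd[OF sH] by blast
    then obtain K where K: "K \<in> cyclic_subgroups G" "subgroup_covered_by G K H"
      using cyclic_lower_cover[OF less.prems] by metis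
    then have "card K < card H"
      using finite_subgroup[OF sH] psubset_card_mono unfolding subgroup_covered_by_def by blast
    then show ?thesis using less K step by blast
  qed (simp add: triv)
qed

text \<open>Connectedness in the form used for path and cycle graphs: a set of vertices that contains the
  trivial subgroup and is closed under adjacency contains every vertex.\<close>

lemma adj_closed_contains_all:
  assumes "{\<one>} \<in> S" "\<And>K U. K \<in> S \<Longrightarrow> adj K U \<Longrightarrow> U \<in> S" "H \<in> cyclic_subgroups G"
  shows "H \<in> S"
  using assms(3)
proof (induction H rule: cyclic_subgroup_cover_induct)
  case (cover K U)
  then show ?case using assms(2)[of K U] by (simp add: adj_iff)
qed (rule assms(1))

lemma connected_cyclic_subgroup_graph:
  "Digraph_Component.connected (cyclic_subgroup_graph G)"
proof -
  interpret g: graph "cyclic_subgroup_graph G"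
    by (rule graph_cyclic_subgroup_graph[OF fin])
  have r: "{\<one>} \<rightarrow>\<^sup>*\<^bsub>cyclic_subgroup_graph G\<^esub> H" if "H \<in> cyclic_subgroups G" for H
    using that
  proof (induction H rule: cyclic_subgroup_cover_induct)
    case trivial
    show ?case by (simp add: g.reachable_refl verts_eq trivial_cyclic_subgroup)
  next
    case (cover K U)
    then have "K \<rightarrow>\<^bsub>cyclic_subgroup_graph G\<^esub> U" by (simp add: adj_iff)
    with cover.IH show ?case by (rule g.reachable_adj_trans)
  qed
  have "H \<rightarrow>\<^sup>*\<^bsub>cyclic_subgroup_graph G\<^esub> K" if "H \<in> cyclic_subgroups G" "K \<in> cyclic_subgroups G" for H K
    using r[OF that(1)] r[OF that(2)] g.symmetric_reachable' g.reachable_trans by blast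
  then have "strongly_connected (cyclic_subgroup_graph G)"
    using trivial_cyclic_subgroup by (auto simp: strongly_connected_def verts_eq)
  moreover have "with_proj (mk_symmetric (cyclic_subgroup_graph G)) = cyclic_subgroup_graph G"
  proof -
    have "(\<Union>e\<in>A. {(fst e, snd e), (snd e, fst e)}) = A" if "sym A" for A :: "('a set \<times> 'a set) set"
      using that by (force dest: symD)
    moreover have "sym {(H1, H2). H1 \<in> cyclic_subgroups G \<and> H2 \<in> cyclic_subgroups G \<and>
        (subgroup_covered_by G H1 H2 \<or> subgroup_covered_by G H2 H1)}"
      by (intro symI) blast
    ultimately show ?thesis
      by (simp add: mk_symmetric_def cyclic_subgroup_graph_def)
  qed
  ultimately show ?thesis
    by (simp add: Digraph_Component.connected_def)
qed

end

section \<open>Vertex degrees in paths and cycles\<close>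

text \<open>In a path graph, no vertex has three distinct neighbours, some vertex has at most one
  neighbour, and there are at least two vertices.\<close>

lemma path_graph_degree:
  assumes "path_graph D"
  shows "(v, a) \<in> arcs_ends D \<Longrightarrow> (v, b) \<in> arcs_ends D \<Longrightarrow> (v, c) \<in> arcs_ends D \<Longrightarrow>
      a = b \<or> b = c \<or> a = c"
    and "\<exists>v\<in>verts D. \<forall>a b. (v, a) \<in> arcs_ends D \<longrightarrow> (v, b) \<in> arcs_ends D \<longrightarrow> a = b"
    and "2 \<le> card (verts D)"
proof -
  obtain vs where vs: "distinct vs" "2 \<le> length vs" "verts D = set vs"
    and arcs: "arcs_ends D = {(vs ! i, vs ! j) | i j.
          i < length vs \<and> j < length vs \<and> (j = Suc i \<or> i = Suc j)}"
    using assms unfolding path_graph_def by blast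
  have nbr: "\<exists>j<length vs. w = vs ! j \<and> (j = Suc i \<or> i = Suc j)"
    if h: "(vs ! i, w) \<in> arcs_ends D" "i < length vs" for i w
  proof -
    obtain i' j where "vs ! i = vs ! i'" "w = vs ! j" "i' < length vs" "j < length vs" "j = Suc i' \<or> i' = Suc j"
      using h(1) unfolding arcs by blast
    moreover then have "i' = i" using h(2) vs(1) by (simp add: nth_eq_iff_index_eq)
    ultimately show ?thesis by blast
  qed
  show "a = b \<or> b = c \<or> a = c"
    if va: "(v, a) \<in> arcs_ends D" and vb: "(v, b) \<in> arcs_ends D" and vc: "(v, c) \<in> arcs_ends D"
  proof -
    obtain i where i: "i < length vs" "v = vs ! i" using va arcs by auto
    obtain ja jb jc where "a = vs ! ja" "b = vs ! jb" "c = vs ! jc"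
      "ja = Suc i \<or> i = Suc ja" "jb = Suc i \<or> i = Suc jb" "jc = Suc i \<or> i = Suc jc"
      using nbr i va vb vc by metis
    then show ?thesis by auto
  qed
  have "vs ! 0 \<in> verts D" using vs by (metis nth_mem le_less_trans less_2_cases_iff zero_less_numeral less_le_trans)
  moreover have "a = b" if "(vs ! 0, a) \<in> arcs_ends D" "(vs ! 0, b) \<in> arcs_ends D" for a b
    using nbr[OF that(1)] nbr[OF that(2)] vs(2) by (cases "vs = []") auto
  ultimately show "\<exists>v\<in>verts D. \<forall>a b. (v, a) \<in> arcs_ends D \<longrightarrow> (v, b) \<in> arcs_ends D \<longrightarrow> a = b"
    by blast
  show "2 \<le> card (verts D)" using vs by (simp add: distinct_card)
qed

text \<open>In a cycle graph, every vertex has exactly two neighbours.\<close>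

lemma cycle_graph_degree:
  assumes "cycle_graph D"
  shows "(v, a) \<in> arcs_ends D \<Longrightarrow> (v, b) \<in> arcs_ends D \<Longrightarrow> (v, c) \<in> arcs_ends D \<Longrightarrow>
      a = b \<or> b = c \<or> a = c"
    and "v \<in> verts D \<Longrightarrow> \<exists>a b. a \<noteq> b \<and> (v, a) \<in> arcs_ends D \<and> (v, b) \<in> arcs_ends D"
proof -
  obtain vs where vs: "distinct vs" "3 \<le> length vs" "verts D = set vs"
    and arcs: "arcs_ends D = {(vs ! i, vs ! j) | i j.
          i < length vs \<and> j < length vs \<and> (j = Suc i mod length vs \<or> i = Suc j mod length vs)}"
    using assms unfolding cycle_graph_def by blast
  let ?n = "length vs"
  have nbr: "\<exists>j<?n. w = vs ! j \<and> (j = Suc i mod ?n \<or> i = Suc j mod ?n)"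
    if h: "(vs ! i, w) \<in> arcs_ends D" "i < ?n" for i w
  proof -
    obtain i' j where "vs ! i = vs ! i'" "w = vs ! j" "i' < ?n" "j < ?n" "j = Suc i' mod ?n \<or> i' = Suc j mod ?n"
      using h(1) unfolding arcs by blast
    moreover then have "i' = i" using h(2) vs(1) by (simp add: nth_eq_iff_index_eq)
    ultimately show ?thesis by blast
  qed
  have uniq: "j = k" if "j < ?n" "k < ?n" "Suc j mod ?n = Suc k mod ?n" for j k
    using that by (auto simp: mod_Suc split: if_splits)
  show "a = b \<or> b = c \<or> a = c"
    if va: "(v, a) \<in> arcs_ends D" and vb: "(v, b) \<in> arcs_ends D" and vc: "(v, c) \<in> arcs_ends D"
  proof -
    obtain i where i: "i < ?n" "v = vs ! i" using va arcs by auto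
    obtain ja where "ja < ?n" "a = vs ! ja" "ja = Suc i mod ?n \<or> i = Suc ja mod ?n"
      using nbr i va by metis
    moreover obtain jb where "jb < ?n" "b = vs ! jb" "jb = Suc i mod ?n \<or> i = Suc jb mod ?n"
      using nbr i vb by metis
    moreover obtain jc where "jc < ?n" "c = vs ! jc" "jc = Suc i mod ?n \<or> i = Suc jc mod ?n"
      using nbr i vc by metis
    ultimately show ?thesis using uniq by metis
  qed
  assume "v \<in> verts D"
  then obtain i where i: "i < ?n" "v = vs ! i" using vs(3) by (auto simp: in_set_conv_nth)
  let ?j = "Suc i mod ?n" and ?k = "if i = 0 then ?n - 1 else i - 1"
  have "0 < ?n" using i(1) by linarith
  then have j: "?j < ?n" and k: "?k < ?n" using i by auto
  have ne: "?j \<noteq> ?k" using vs(2) i by (auto simp: mod_Suc)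
  have "i = Suc ?k mod ?n" using vs(2) i by (auto simp: mod_Suc)
  then have "(v, vs ! ?j) \<in> arcs_ends D" "(v, vs ! ?k) \<in> arcs_ends D"
    using arcs i j k by blast+
  moreover have "vs ! ?j \<noteq> vs ! ?k" using ne j k vs(1) by (simp add: nth_eq_iff_index_eq)
  ultimately show "\<exists>a b. a \<noteq> b \<and> (v, a) \<in> arcs_ends D \<and> (v, b) \<in> arcs_ends D" by blast
qed

text \<open>Adjacency only has to be compared on the list of vertices; the relation \<open>R\<close> on indices is
  arbitrary.\<close>

lemma (in wf_digraph) arcs_ends_by_index:
  assumes "verts G = set vs"
    and "\<And>i j. i < length vs \<Longrightarrow> j < length vs \<Longrightarrow> (vs ! i, vs ! j) \<in> arcs_ends G \<longleftrightarrow> R i j"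
  shows "arcs_ends G = {(vs ! i, vs ! j) | i j. i < length vs \<and> j < length vs \<and> R i j}"
proof (intro equalityI subsetI)
  fix e assume e: "e \<in> arcs_ends G"
  obtain u w where uw: "e = (u, w)" by (cases e)
  then have "u \<in> set vs" "w \<in> set vs"
    using e adj_in_verts assms(1) by auto
  then show "e \<in> {(vs ! i, vs ! j) | i j. i < length vs \<and> j < length vs \<and> R i j}"
    using assms(2) e uw by (fastforce simp: in_set_conv_nth)
qed (use assms(2) in blast)

section \<open>The graph of a finite cyclic group\<close>

text \<open>A finite cyclic group with a chosen generator.\<close>

locale finite_cyclic_group = finite_group +
  fixes g
  assumes gen: "g \<in> carrier G" "carrier G = generate G {g}"
begin

text \<open>The subgroup of order \<open>d\<close>, for \<open>d\<close> a divisor of the order of the group; for other \<open>d\<close> it is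
  some cyclic subgroup without further meaning.\<close>

definition sub :: "nat \<Rightarrow> 'a set" where
  "sub d = generate G {g [^] (ord g div d)}"

lemma sub_cyclic: "sub d \<in> cyclic_subgroups G"
  by (simp add: sub_def gen(1) cyclic_subgroupI)

lemma sub_subgroup: "subgroup (sub d) G"
  by (rule cyclic_subgroup_subgroup[OF sub_cyclic])

lemma card_sub: "d dvd ord g \<Longrightarrow> card (sub d) = d"
  unfolding sub_def by (rule generate_pow_roots(2)[OF gen(1)])

lemma sub_inj: "d dvd ord g \<Longrightarrow> e dvd ord g \<Longrightarrow> sub d = sub e \<longleftrightarrow> d = e"
  using card_sub by metis

lemma cyclic_subgroups_sub: "cyclic_subgroups G = sub ` {d. d dvd ord g}"
proof (intro equalityI subsetI)
  fix H assume "H \<in> cyclic_subgroups G"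
  then have H: "subgroup H G" by (rule cyclic_subgroup_subgroup)
  have c: "card (generate G {g}) = ord g" using generate_pow_card[OF gen(1)] by simp
  have sub: "H \<subseteq> generate G {g}" using subgroup.subset[OF H] gen(2) by simp
  have "H = sub (card H)"
    unfolding sub_def by (rule subgroup_of_cyclic[OF gen(1) H sub])
  moreover have "card H dvd ord g"
    using subgroup_card_dvd[OF H subgroup_generate[OF gen(1)] sub] c by simp
  ultimately show "H \<in> sub ` {d. d dvd ord g}" by blast
qed (auto simp: sub_cyclic)

lemma sub_mono:
  assumes "d dvd e" "e dvd ord g"
  shows "sub d \<subseteq> sub e"
proof -
  have d: "d dvd ord g" using assms dvd_trans by blast
  have "y [^] e = \<one>" if "y \<in> generate G {g}" "y [^] d = \<one>" for y
    using that assms(1) gen pow_eq_id by (metis dvd_trans)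
  then show ?thesis
    unfolding sub_def generate_pow_roots(1)[OF gen(1) d] generate_pow_roots(1)[OF gen(1) assms(2)]
    by blast
qed

lemma sub_adj_iff:
  assumes "d dvd ord g" "e dvd ord g"
  shows "adj (sub d) (sub e) \<longleftrightarrow> (\<exists>q. Factorial_Ring.prime q \<and> (e = q * d \<or> d = q * e))"
proof -
  have "subgroup_covered_by G (sub d) (sub e) \<longleftrightarrow> (\<exists>q. Factorial_Ring.prime q \<and> e = q * d)"
    if "d dvd ord g" "e dvd ord g" for d e
  proof
    assume "subgroup_covered_by G (sub d) (sub e)"
    from covered_card[OF sub_cyclic sub_subgroup this]
    show "\<exists>q. Factorial_Ring.prime q \<and> e = q * d" using card_sub that by metis
  next
    assume "\<exists>q. Factorial_Ring.prime q \<and> e = q * d"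
    then obtain q where "Factorial_Ring.prime q" "e = q * d" by blast
    then show "subgroup_covered_by G (sub d) (sub e)"
      using covered_if_prime_index[OF sub_subgroup sub_subgroup sub_mono, of d e q] that card_sub by simp
  qed
  from this[OF assms] this[OF assms(2,1)] show ?thesis
    by (auto simp: adj_iff sub_cyclic)
qed

lemma path_graph_if_prime_power:
  assumes "Factorial_Ring.prime p" "0 < k" "ord g = p ^ k"
  shows "path_graph (cyclic_subgroup_graph G)"
proof -
  interpret gr: graph "cyclic_subgroup_graph G"
    by (rule graph_cyclic_subgroup_graph[OF fin])
  define vs where "vs = map (\<lambda>i. sub (p ^ i)) [0..<Suc k]"
  have p1: "1 < p" using assms(1) prime_gt_1_nat by blast
  have dv: "p ^ i dvd ord g" if "i < Suc k" for i
    using that assms(3) by (simp add: le_imp_power_dvd)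
  have len: "length vs = Suc k" by (simp add: vs_def)
  have nth: "vs ! i = sub (p ^ i)" if "i < Suc k" for i
    unfolding vs_def using that by (metis add_0 length_upt minus_nat.diff_0 nth_map nth_upt)
  have "distinct vs"
    unfolding distinct_conv_nth len using nth dv sub_inj p1 by (simp add: power_inject_exp)
  moreover have verts: "verts (cyclic_subgroup_graph G) = set vs"
  proof -
    have "{d. d dvd ord g} = (\<lambda>i. p ^ i) ` {..k}"
      using divides_primepow_nat[OF assms(1)] assms(3) by auto
    moreover have "set [0..<Suc k] = {..k}" by auto
    ultimately show ?thesis
      by (simp only: verts_eq cyclic_subgroups_sub vs_def set_map image_image)
  qed
  moreover have "(vs ! i, vs ! j) \<in> arcs_ends (cyclic_subgroup_graph G) \<longleftrightarrow> j = Suc i \<or> i = Suc j"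
    if "i < length vs" "j < length vs" for i j
  proof -
    have *: "(\<exists>q. Factorial_Ring.prime q \<and> p ^ j = q * p ^ i) \<longleftrightarrow> j = Suc i" for i j
    proof
      assume "\<exists>q. Factorial_Ring.prime q \<and> p ^ j = q * p ^ i"
      then obtain q where q: "Factorial_Ring.prime q" "p ^ j = q * p ^ i" by blast
      then have "q dvd p ^ j" by simp
      then have "q = p" using prime_dvd_power[OF q(1)] primes_dvd_imp_eq[OF q(1) assms(1)] by blast
      then have "p ^ j = p ^ Suc i" using q(2) by simp
      then show "j = Suc i" using p1 power_inject_exp by blast
    qed (use assms(1) in auto)
    then have "(\<exists>q. Factorial_Ring.prime q \<and> (p ^ j = q * p ^ i \<or> p ^ i = q * p ^ j)) \<longleftrightarrow>
        j = Suc i \<or> i = Suc j"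
      using *[of j i] *[of i j] by blast
    then show ?thesis
      using that sub_adj_iff[of "p ^ i" "p ^ j"] dv nth len by simp
  qed
  ultimately show ?thesis
    unfolding path_graph_def using gr.graph_axioms gr.arcs_ends_by_index[OF verts, of "\<lambda>i j. j = Suc i \<or> i = Suc j"]
      len assms(2) by (intro conjI exI[of _ vs]) auto
qed

lemma cycle_graph_if_two_primes:
  assumes p: "Factorial_Ring.prime p" and q: "Factorial_Ring.prime q" and ne: "p \<noteq> q" and o: "ord g = p * q"
  shows "cycle_graph (cyclic_subgroup_graph G)"
proof -
  interpret gr: graph "cyclic_subgroup_graph G"
    by (rule graph_cyclic_subgroup_graph[OF fin])
  \<comment> \<open>The orders of the subgroups, in cyclic order around the graph.\<close>
  define ds where "ds = [1, p, p * q, q]"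
  define vs where "vs = map sub ds"
  \<comment> \<open>Orders of adjacent subgroups differ by a prime factor.\<close>
  define R where "R d e \<longleftrightarrow> (\<exists>q. Factorial_Ring.prime q \<and> (e = q * d \<or> d = q * e))" for d e :: nat
  have gt: "1 < p" "1 < q" using p q prime_gt_1_nat by blast+
  have div_iff: "d dvd p * q \<longleftrightarrow> d \<in> set ds" for d
  proof
    assume "d dvd p * q"
    then obtain a b where "d = a * b" "a dvd p" "b dvd q" by (metis division_decomp)
    moreover from this have "a = 1 \<or> a = p" "b = 1 \<or> b = q"
      using p q prime_nat_iff by blast+
    ultimately show "d \<in> set ds"
      by (auto simp: ds_def)
  qed (auto simp: ds_def)
  have verts: "verts (cyclic_subgroup_graph G) = set vs"
    using div_iff by (auto simp: verts_eq cyclic_subgroups_sub o vs_def)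
  have dist: "distinct ds" using gt ne by (auto simp: ds_def)
  have "inj_on sub (set ds)"
    by (rule inj_onI) (use sub_inj div_iff o in auto)
  then have dvs: "distinct vs" using dist by (simp add: vs_def distinct_map)
  have sym: "R d e \<longleftrightarrow> R e d" for d e by (auto simp: R_def)
  have nrefl: "\<not> R d d" if "0 < d" for d
    using that by (auto simp: R_def)
  have "R 1 p" "R p (p * q)" "R (p * q) q" "R 1 q" 
    using p q by (auto simp: R_def)
  moreover have "\<not> R 1 (p * q)"
    using gt prime_product[of p q] by (auto simp: R_def)
  moreover have "\<not> R p q"
  proof
    assume "R p q"
    then obtain r where r: "Factorial_Ring.prime r" "q = r * p \<or> p = r * q" by (auto simp: R_def)
    then have "r = 1 \<or> p = 1 \<or> q = 1"
      using p q prime_product[of r p] prime_product[of r q] by auto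
    then show False using r(1) gt by auto
  qed
  ultimately have adjR: "R (ds ! i) (ds ! j) \<longleftrightarrow> j = Suc i mod 4 \<or> i = Suc j mod 4" if "i < 4" "j < 4" for i j
  proof -
    have "i = 0 \<or> i = 1 \<or> i = 2 \<or> i = 3" "j = 0 \<or> j = 1 \<or> j = 2 \<or> j = 3" using that by auto
    then show ?thesis
      using gt nrefl sym \<open>R 1 p\<close> \<open>R p (p * q)\<close> \<open>R (p * q) q\<close> \<open>R 1 q\<close> \<open>\<not> R 1 (p * q)\<close> \<open>\<not> R p q\<close>
      by (elim disjE) (simp_all add: ds_def)
  qed
  have len: "length vs = 4" "length ds = 4" by (simp_all add: vs_def ds_def)
  have "(vs ! i, vs ! j) \<in> arcs_ends (cyclic_subgroup_graph G) \<longleftrightarrow>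
      j = Suc i mod length vs \<or> i = Suc j mod length vs"
    if "i < length vs" "j < length vs" for i j
  proof -
    have "ds ! i dvd ord g" "ds ! j dvd ord g" "i < 4" "j < 4" using that div_iff len o by auto
    then show ?thesis
      using sub_adj_iff[of "ds ! i" "ds ! j"] adjR len that R_def by (simp add: vs_def)
  qed
  from gr.arcs_ends_by_index[OF verts this] show ?thesis
    unfolding cycle_graph_def using gr.graph_axioms verts dvs len
    by (intro conjI exI[of _ vs]) auto
qed

end

context finite_group
begin

text \<open>The group \<open>integer_mod_group 0\<close> is the infinite group of integers, hence the condition
  \<open>0 < n\<close>.\<close>

lemma iso_integer_mod_group_iff:
  assumes n: "0 < n"
  shows "G \<cong> integer_mod_group n \<longleftrightarrow> (\<exists>g\<in>carrier G. carrier G = generate G {g} \<and> ord g = n)"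
proof
  let ?Z = "integer_mod_group n"
  assume "G \<cong> ?Z"
  then have "?Z \<cong> G" by (rule iso_sym)
  then obtain f where f: "f \<in> iso ?Z G" by (auto simp: is_iso_def)
  then interpret f: group_hom ?Z G f
    by (simp add: group_hom_def group_hom_axioms_def iso_def)
  have im: "f ` carrier ?Z = carrier G" and inj: "inj_on f (carrier ?Z)"
    using f by (auto simp: iso_def bij_betw_def)
  define u :: int where "u = 1 mod int n"
  have u: "u \<in> carrier ?Z" using n by (simp add: u_def carrier_integer_mod_group)
  have fu: "f u \<in> carrier G" using u by simp
  have "carrier G \<subseteq> generate G {f u}"
  proof
    fix y assume "y \<in> carrier G"
    then obtain k where k: "k \<in> carrier ?Z" "y = f k" using im by auto
    have "pow ?Z u (nat k) = k"
      using k(1) n by (auto simp: carrier_integer_mod_group u_def mod_mult_right_eq)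
    then have "y = f u [^] nat k" using k u f.hom_nat_pow by metis
    then show "y \<in> generate G {f u}" using fu by (simp add: generate_eq_pow)
  qed
  then have eq: "carrier G = generate G {f u}"
    using subgroup.subset[OF subgroup_generate[OF fu]] by blast
  have "card (carrier G) = card (carrier ?Z)" using im inj card_image by metis
  then have "ord (f u) = n"
    using generate_pow_card[OF fu] eq n by (simp add: carrier_integer_mod_group)
  with eq fu show "\<exists>g\<in>carrier G. carrier G = generate G {g} \<and> ord g = n" by blast
next
  let ?Z = "integer_mod_group n"
  assume "\<exists>g\<in>carrier G. carrier G = generate G {g} \<and> ord g = n"
  then obtain g where g: "g \<in> carrier G" "carrier G = generate G {g}" "ord g = n" by blast
  define f where "f k = g [^] (k::int)" for k
  have "f \<in> hom ?Z G"
  proof (rule homI)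
    fix x y
    have "g [^] ((x + y) mod int n) = g [^] (x + y)"
      using g int_pow_eq[of g "(x + y) mod int n" "x + y"] by (simp add: minus_mod_eq_mult_div)
    then show "f (x \<otimes>\<^bsub>?Z\<^esub> y) = f x \<otimes> f y"
      using g by (simp add: f_def int_pow_mult)
  qed (simp add: f_def g(1))
  moreover have inj: "inj_on f (carrier ?Z)"
  proof (rule inj_onI)
    fix x y assume xy: "x \<in> carrier ?Z" "y \<in> carrier ?Z" "f x = f y"
    then have "int n dvd y - x" using g int_pow_eq[of g x y] by (simp add: f_def)
    moreover have "\<bar>y - x\<bar> < int n" using xy n by (auto simp: carrier_integer_mod_group)
    ultimately show "x = y" using zdvd_not_zless[of "\<bar>y - x\<bar>" "int n"] by force
  qed
  moreover have "f ` carrier ?Z = carrier G"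
  proof (rule card_subset_eq[OF fin])
    show "f ` carrier ?Z \<subseteq> carrier G" using g by (auto simp: f_def)
    show "card (f ` carrier ?Z) = card (carrier G)"
      using card_image[OF inj] generate_pow_card[OF g(1)] g n by (simp add: carrier_integer_mod_group)
  qed
  ultimately have "f \<in> iso ?Z G" by (simp add: iso_def bij_betw_def)
  then have "?Z \<cong> G" by (auto simp: is_iso_def)
  then show "G \<cong> ?Z" by (rule group.iso_sym[OF group_integer_mod_group])
qed

lemma iso_integer_mod_groupE:
  assumes "G \<cong> integer_mod_group n" "0 < n"
  obtains g where "finite_cyclic_group G g" "ord g = n"
proof -
  obtain g where "g \<in> carrier G" "carrier G = generate G {g}" "ord g = n"
    using iso_integer_mod_group_iff[OF assms(2)] assms(1) by blast
  then show ?thesis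
    using that[of g] finite_group_axioms by (simp add: finite_cyclic_group_def finite_cyclic_group_axioms_def)
qed

section \<open>Complete graphs\<close>

lemma complete_graphI:
  assumes "\<And>H K. H \<in> cyclic_subgroups G \<Longrightarrow> K \<in> cyclic_subgroups G \<Longrightarrow> H \<noteq> K \<Longrightarrow> adj H K"
  shows "complete_graph (cyclic_subgroup_graph G)"
proof -
  have "adj H K \<longleftrightarrow> H \<in> cyclic_subgroups G \<and> K \<in> cyclic_subgroups G \<and> H \<noteq> K" for H K
    using assms[of H K] by (auto simp: adj_iff subgroup_covered_by_def)
  then show ?thesis
    using graph_cyclic_subgroup_graph[OF fin]
    by (auto simp: complete_graph_def complete_digraph_def verts_eq)
qed

lemma trivial_group_iff_carrier: "trivial_group G \<longleftrightarrow> carrier G = {\<one>}"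
  by (simp add: trivial_group_def group_axioms)

lemma complete_graph_iff:
  "complete_graph (cyclic_subgroup_graph G) \<longleftrightarrow>
    trivial_group G \<or> (\<exists>p::nat. Factorial_Ring.prime p \<and> G \<cong> integer_mod_group p)"
proof
  assume "complete_graph (cyclic_subgroup_graph G)"
  then have adj: "adj H K" if "H \<in> cyclic_subgroups G" "K \<in> cyclic_subgroups G" "H \<noteq> K" for H K
    using that by (auto simp: complete_graph_def complete_digraph_def verts_eq)
  show "trivial_group G \<or> (\<exists>p::nat. Factorial_Ring.prime p \<and> G \<cong> integer_mod_group p)"
  proof (cases "trivial_group G")
    case False
    then obtain x where x: "x \<in> carrier G" "x \<noteq> \<one>"
      unfolding trivial_group_iff_carrier using one_closed by blast
    have prime: "Factorial_Ring.prime (card (generate G {y}))" if "y \<in> carrier G" "y \<noteq> \<one>" for y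
      using adj[OF trivial_cyclic_subgroup cyclic_subgroupI[OF that(1)]] that(2) generate_self[of y]
      by (auto simp: adj_trivial_iff)
    have ncov: "\<not> subgroup_covered_by G (generate G {y}) (generate G {z})"
      if y: "y \<in> carrier G" "y \<noteq> \<one>" and z: "z \<in> carrier G" "z \<noteq> \<one>" for y z
    proof
      assume "subgroup_covered_by G (generate G {y}) (generate G {z})"
      then obtain q where "Factorial_Ring.prime q" "card (generate G {z}) = q * card (generate G {y})"
        using covered_card[OF cyclic_subgroupI[OF z(1)] subgroup_generate[OF y(1)]] by metis
      then show False
        using prime[OF y] prime[OF z] prime_product by (metis not_prime_1)
    qed
    have "y \<in> generate G {x}" if "y \<in> carrier G" for y
    proof (cases "y = \<one>")
      case False
      have "generate G {y} = generate G {x}"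
      proof (rule ccontr)
        assume "generate G {y} \<noteq> generate G {x}"
        then have "adj (generate G {y}) (generate G {x})"
          using adj[OF cyclic_subgroupI[OF that] cyclic_subgroupI[OF x(1)]] by blast
        then show False
          using ncov[OF that False x] ncov[OF x that False] by (simp add: adj_iff)
      qed
      then show ?thesis using generate_self by blast
    qed (use subgroup.one_closed[OF subgroup_generate[OF x(1)]] in simp)
    then have "carrier G = generate G {x}"
      using subgroup.subset[OF subgroup_generate[OF x(1)]] by blast
    moreover have p: "Factorial_Ring.prime (ord x)"
      using prime[OF x] generate_pow_card[OF x(1)] by simp
    ultimately have "G \<cong> integer_mod_group (ord x)"
      using iso_integer_mod_group_iff[OF prime_gt_0_nat[OF p]] x(1) by blast
    with p show ?thesis by blast
  qed simp
next
  assume "trivial_group G \<or> (\<exists>p::nat. Factorial_Ring.prime p \<and> G \<cong> integer_mod_group p)"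
  then show "complete_graph (cyclic_subgroup_graph G)"
  proof (elim disjE exE conjE)
    assume "trivial_group G"
    then have "cyclic_subgroups G = {{\<one>}}"
      by (simp add: cyclic_subgroups_eq trivial_group_iff_carrier generate_one)
    then show ?thesis by (intro complete_graphI) auto
  next
    fix p :: nat assume p: "Factorial_Ring.prime p" and iso: "G \<cong> integer_mod_group p"
    obtain g where "finite_cyclic_group G g" and o: "ord g = p"
      using iso_integer_mod_groupE[OF iso prime_gt_0_nat[OF p]] .
    then interpret C: finite_cyclic_group G g by simp
    have "d dvd p \<longleftrightarrow> d = 1 \<or> d = p" for d using p by (auto simp: prime_nat_iff)
    then have cyc: "cyclic_subgroups G = {C.sub 1, C.sub p}"
      unfolding C.cyclic_subgroups_sub o by auto
    have "adj (C.sub 1) (C.sub p)" using C.sub_adj_iff[of 1 p] p o by auto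
    then show ?thesis
      using adj_sym by (intro complete_graphI) (auto simp: cyc)
  qed
qed

section \<open>Paths and cycles\<close>

lemma adj_trivial_generate:
  "x \<in> carrier G \<Longrightarrow> Factorial_Ring.prime (ord x) \<Longrightarrow> adj {\<one>} (generate G {x})"
  by (simp add: adj_trivial_iff cyclic_subgroupI generate_pow_card)

text \<open>If there are exactly two subgroups of prime order, they commute elementwise and have different
  orders, so their product is cyclic.\<close>

lemma two_prime_order_subgroups:
  assumes P: "adj {\<one>} P" and Q: "adj {\<one>} Q" and ne: "P \<noteq> Q"
    and only: "\<And>R. adj {\<one>} R \<Longrightarrow> R = P \<or> R = Q"
  obtains V where "V \<in> cyclic_subgroups G" "P \<subseteq> V" "Q \<subseteq> V" "card P \<noteq> card Q"
    "card V = card P * card Q"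
proof -
  have cP: "P \<in> cyclic_subgroups G" and pP: "Factorial_Ring.prime (card P)"
    and cQ: "Q \<in> cyclic_subgroups G" and pQ: "Factorial_Ring.prime (card Q)"
    using P Q by (auto simp: adj_trivial_iff)
  note sP = cyclic_subgroup_subgroup[OF cP] and sQ = cyclic_subgroup_subgroup[OF cQ]
  obtain x where x: "x \<in> carrier G" "P = generate G {x}" "ord x = card P"
    using cP by (rule cyclic_subgroupE)
  obtain y where y: "y \<in> carrier G" "Q = generate G {y}" "ord y = card Q"
    using cQ by (rule cyclic_subgroupE)
  have xP: "x \<in> P" and yQ: "y \<in> Q" using generate_self x(2) y(2) by auto
  have PQ: "z = \<one>" if "z \<in> P" "z \<in> Q" for z
    using prime_subgroup_generate(1)[OF sP pP that(1)] prime_subgroup_generate(1)[OF sQ pQ that(2)] ne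
    by blast
  have x1: "x \<noteq> \<one>" and y1: "y \<noteq> \<one>"
    using x(3) y(3) pP pQ by (metis not_prime_1 ord_id)+
  \<comment> \<open>Stated for a generic pair, to be used for both orders of \<open>P\<close> and \<open>Q\<close>.\<close>
  have conj: "b \<otimes> a \<otimes> inv b \<in> A"
    if A: "subgroup A G" and B: "subgroup B G" and ab: "a \<in> A" "b \<in> B" and a1: "a \<noteq> \<one>"
      and pa: "Factorial_Ring.prime (ord a)"
      and AB: "\<And>R. adj {\<one>} R \<Longrightarrow> R = A \<or> R = B" and tr: "\<And>z. z \<in> A \<Longrightarrow> z \<in> B \<Longrightarrow> z = \<one>" for A B a b
  proof -
    have c: "a \<in> carrier G" "b \<in> carrier G" using A B ab by (auto intro: subgroup.mem_carrier)
    let ?w = "b \<otimes> a \<otimes> inv b"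
    have "generate G {?w} = A \<or> generate G {?w} = B"
      using AB adj_trivial_generate[of ?w] c pa ord_conj by simp
    then have "?w \<in> A \<or> ?w \<in> B" using generate_self by blast
    moreover have "?w \<notin> B"
    proof
      assume "?w \<in> B"
      then have "inv b \<otimes> ?w \<otimes> b \<in> B"
        using ab(2) subgroup.m_closed[OF B] subgroup.m_inv_closed[OF B] by simp
      moreover have "inv b \<otimes> ?w \<otimes> b = a"
        using c by (rule conj_cancel)
      ultimately show False using tr ab(1) a1 by simp
    qed
    ultimately show ?thesis by simp
  qed
  have c1: "y \<otimes> x \<otimes> inv y \<in> P"
    using conj[OF sP sQ xP yQ x1 _ only PQ] x(3) pP by simp
  have c2: "x \<otimes> y \<otimes> inv x \<in> Q"
  proof (rule conj[OF sQ sP yQ xP y1])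
    show "Factorial_Ring.prime (ord y)" using y(3) pQ by simp
  qed (use only PQ in blast)+
  \<comment> \<open>The commutator of \<open>x\<close> and \<open>y\<close> lies in the trivial intersection of \<open>P\<close> and \<open>Q\<close>.\<close>
  have "y \<otimes> x \<otimes> inv y \<otimes> inv x \<in> P"
    using c1 xP subgroup.m_closed[OF sP] subgroup.m_inv_closed[OF sP] by simp
  moreover have "y \<otimes> inv (x \<otimes> y \<otimes> inv x) \<in> Q"
    using c2 yQ subgroup.m_closed[OF sQ] subgroup.m_inv_closed[OF sQ] by simp
  moreover have "y \<otimes> inv (x \<otimes> y \<otimes> inv x) = y \<otimes> x \<otimes> inv y \<otimes> inv x"
    using x(1) y(1) by (simp add: inv_mult_group m_assoc)
  ultimately have "y \<otimes> x \<otimes> inv y \<otimes> inv x = \<one>" using PQ by simp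
  then have comm: "x \<otimes> y = y \<otimes> x"
  proof -
    have "y \<otimes> x = (y \<otimes> x \<otimes> inv y \<otimes> inv x) \<otimes> (x \<otimes> y)"
      using x(1) y(1) by (simp add: m_assoc inv_cancel_left)
    also have "\<dots> = x \<otimes> y"
      using x(1) y(1) \<open>y \<otimes> x \<otimes> inv y \<otimes> inv x = \<one>\<close> by simp
    finally show ?thesis by simp
  qed
  let ?w = "x \<otimes> y"
  have w: "?w \<in> carrier G" using x(1) y(1) by simp
  have pw: "?w [^] n = x [^] n \<otimes> y [^] n" for n :: nat
    using pow_mult_distrib[OF comm x(1) y(1)] .
  have neq: "card P \<noteq> card Q"
  proof
    assume eq: "card P = card Q"
    have "?w [^] card P = \<one>"
      unfolding pw using x(3) y(3) eq x(1) y(1) by (metis l_one pow_ord_eq_1 one_closed)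
    then have "ord ?w dvd card P" using pow_eq_id[OF w] by simp
    moreover have "?w \<noteq> \<one>"
    proof
      assume "?w = \<one>"
      then have "inv x = y" using x(1) y(1) comm by (metis inv_equality)
      then have "y \<in> P" using xP subgroup.m_inv_closed[OF sP] by blast
      then show False using PQ yQ y1 by blast
    qed
    ultimately have "ord ?w = card P" using pP ord_eq_1[OF w] by (metis prime_nat_iff)
    then have "generate G {?w} = P \<or> generate G {?w} = Q"
      using only adj_trivial_generate[OF w] pP by simp
    then have "?w \<in> P \<or> ?w \<in> Q" using generate_self by blast
    then show False
    proof
      assume "?w \<in> P"
      then have "inv x \<otimes> ?w \<in> P" using xP subgroup.m_closed[OF sP] subgroup.m_inv_closed[OF sP] by simp
      then have "y \<in> P" using x(1) y(1) by (simp add: m_assoc[symmetric])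
      then show False using PQ yQ y1 by blast
    next
      assume "?w \<in> Q"
      then have "?w \<otimes> inv y \<in> Q" using yQ subgroup.m_closed[OF sQ] subgroup.m_inv_closed[OF sQ] by simp
      then have "x \<in> Q" using x(1) y(1) by (simp add: m_assoc)
      then show False using PQ xP x1 by blast
    qed
  qed
  let ?V = "generate G {?w}"
  note sV = subgroup_generate[OF w]
  have ndvd: "\<not> card P dvd card Q" "\<not> card Q dvd card P"
    using neq pP pQ primes_dvd_imp_eq by metis+
  have "?w [^] card Q \<in> ?V" "?w [^] card P \<in> ?V"
    using subgroup_pow[OF sV generate_self] by blast+
  then have V: "x [^] card Q \<in> ?V" "y [^] card P \<in> ?V"
    unfolding pw using x y by (metis pow_ord_eq_1 r_one nat_pow_closed, metis pow_ord_eq_1 l_one nat_pow_closed)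
  have "x [^] card Q \<noteq> \<one>" "y [^] card P \<noteq> \<one>"
    using ndvd pow_eq_id x y by simp_all
  then have "generate G {x [^] card Q} = P" "generate G {y [^] card P} = Q"
    using prime_subgroup_generate(1)[OF sP pP subgroup_pow[OF sP xP]]
      prime_subgroup_generate(1)[OF sQ pQ subgroup_pow[OF sQ yQ]] by simp_all
  then have PV: "P \<subseteq> ?V" and QV: "Q \<subseteq> ?V"
    using generate_le[OF sV V(1)] generate_le[OF sV V(2)] by simp_all
  have "card ?V dvd card P * card Q"
    using ord_mul_divides[OF comm x(1) y(1)] x(3) y(3) generate_pow_card[OF w] by simp
  moreover have "card P * card Q dvd card ?V"
    using subgroup_card_dvd[OF sP sV PV] subgroup_card_dvd[OF sQ sV QV] neq pP pQ
    by (simp add: divides_mult primes_coprime)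
  ultimately have "card ?V = card P * card Q" by (rule dvd_antisym)
  with that PV QV neq cyclic_subgroupI[OF w] show ?thesis by blast
qed

text \<open>The 4-cycle through the trivial subgroup, its two neighbours and their product uses up the
  degree of each of its vertices, so by connectedness it is the whole graph. In particular every
  vertex has two neighbours, which rules out a path.\<close>

lemma max_degree_two_four_cycle:
  assumes deg: "\<And>H A B C. adj H A \<Longrightarrow> adj H B \<Longrightarrow> adj H C \<Longrightarrow> A = B \<or> B = C \<or> A = C"
    and P: "adj {\<one>} P" and Q: "adj {\<one>} Q" and ne: "P \<noteq> Q"
  shows "\<exists>p q::nat. Factorial_Ring.prime p \<and> Factorial_Ring.prime q \<and> p \<noteq> q \<and> G \<cong> integer_mod_group (p * q)"
    and "H \<in> cyclic_subgroups G \<Longrightarrow> \<exists>A B. A \<noteq> B \<and> adj H A \<and> adj H B"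
proof -
  have only: "R = P \<or> R = Q" if "adj {\<one>} R" for R
    using deg[OF that P Q] ne by blast
  obtain V where V: "V \<in> cyclic_subgroups G" "P \<subseteq> V" "Q \<subseteq> V" "card P \<noteq> card Q"
    "card V = card P * card Q"
    using two_prime_order_subgroups[OF P Q ne only] by metis
  have cP: "P \<in> cyclic_subgroups G" and pP: "Factorial_Ring.prime (card P)"
    and cQ: "Q \<in> cyclic_subgroups G" and pQ: "Factorial_Ring.prime (card Q)"
    using P Q by (auto simp: adj_trivial_iff)
  note sub = cyclic_subgroup_subgroup
  have PV: "adj P V"
    using covered_if_prime_index[OF sub[OF cP] sub[OF V(1)] V(2), of "card Q"] V cP pQ
    by (simp add: adj_iff)
  have QV: "adj Q V"
    using covered_if_prime_index[OF sub[OF cQ] sub[OF V(1)] V(3), of "card P"] V cQ pP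
    by (simp add: adj_iff)
  have V1: "{\<one>} \<noteq> V"
    using V(5) pP pQ by (auto dest: prime_gt_1_nat)
  let ?S = "{{\<one>}, P, Q, V}"
  have S: "H \<in> ?S" if "H \<in> cyclic_subgroups G" for H
    using _ _ that
  proof (rule adj_closed_contains_all)
    fix K U assume K: "K \<in> ?S" and U: "adj K U"
    from K consider "K = {\<one>}" | "K = P" | "K = Q" | "K = V" by blast
    then show "U \<in> ?S"
    proof cases
      case 1
      then show ?thesis using only U by blast
    next
      case 2
      then show ?thesis using deg[OF adj_sym[OF P] PV, of U] U V1 by blast
    next
      case 3
      then show ?thesis using deg[OF adj_sym[OF Q] QV, of U] U V1 by blast
    next
      case 4
      then show ?thesis using deg[OF adj_sym[OF PV] adj_sym[OF QV], of U] U ne by blast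
    qed
  qed simp
  have two: "\<exists>A B. A \<noteq> B \<and> adj {\<one>} A \<and> adj {\<one>} B" "\<exists>A B. A \<noteq> B \<and> adj P A \<and> adj P B"
    "\<exists>A B. A \<noteq> B \<and> adj Q A \<and> adj Q B" "\<exists>A B. A \<noteq> B \<and> adj V A \<and> adj V B"
    using P Q PV QV ne V1 adj_sym by blast+
  show "\<exists>A B. A \<noteq> B \<and> adj H A \<and> adj H B" if "H \<in> cyclic_subgroups G"
    using S[OF that] two by auto
  obtain g where g: "g \<in> carrier G" "V = generate G {g}" "ord g = card V"
    using V(1) by (rule cyclic_subgroupE)
  have "\<one> \<in> V" using subgroup.one_closed[OF sub[OF V(1)]] .
  then have "z \<in> V" if "z \<in> carrier G" for z
    using S[OF cyclic_subgroupI[OF that]] generate_self[of z] V(2,3) by auto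
  then have "carrier G = generate G {g}"
    using g(2) subgroup.subset[OF sub[OF V(1)]] by blast
  moreover have "0 < card P * card Q" using pP pQ by (simp add: prime_gt_0_nat)
  ultimately have "G \<cong> integer_mod_group (card P * card Q)"
    using iso_integer_mod_group_iff[of "card P * card Q"] g V(5) by auto
  then show "\<exists>p q::nat. Factorial_Ring.prime p \<and> Factorial_Ring.prime q \<and> p \<noteq> q \<and> G \<cong> integer_mod_group (p * q)"
    using pP pQ V(4) by blast
qed

text \<open>A nontrivial cyclic subgroup has a lower cover, so with at most two neighbours it has at most
  one upper cover. Hence no edge leaves the set of subgroups of a maximal cyclic subgroup.\<close>

lemma max_degree_two_chain:
  assumes deg: "\<And>H A B C. adj H A \<Longrightarrow> adj H B \<Longrightarrow> adj H C \<Longrightarrow> A = B \<or> B = C \<or> A = C"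
    and P: "adj {\<one>} P" and only: "\<And>R. adj {\<one>} R \<Longrightarrow> R = P"
  shows "\<exists>(p::nat) k::nat. Factorial_Ring.prime p \<and> 0 < k \<and> G \<cong> integer_mod_group (p ^ k)"
proof -
  note sub = cyclic_subgroup_subgroup
  \<comment> \<open>A cyclic subgroup that is maximal under inclusion.\<close>
  obtain V where V: "V \<in> cyclic_subgroups G" and max: "\<And>W. W \<in> cyclic_subgroups G \<Longrightarrow> V \<subseteq> W \<Longrightarrow> V = W"
    using finite_has_maximal[OF finite_cyclic_subgroups] trivial_cyclic_subgroup by (metis empty_iff)
  let ?S = "{W \<in> cyclic_subgroups G. W \<subseteq> V}"
  have S: "H \<in> ?S" if "H \<in> cyclic_subgroups G" for H
    using _ _ that
  proof (rule adj_closed_contains_all)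
    show "{\<one>} \<in> ?S"
      using trivial_cyclic_subgroup subgroup.one_closed[OF sub[OF V]] by simp
    fix W U assume W: "W \<in> ?S" and U: "adj W U"
    have cU: "U \<in> cyclic_subgroups G" and cov: "subgroup_covered_by G W U \<or> subgroup_covered_by G U W"
      using U by (auto simp: adj_iff)
    show "U \<in> ?S"
    proof (cases "subgroup_covered_by G U W")
      case True
      then show ?thesis using W cU by (auto simp: subgroup_covered_by_def)
    next
      case False
      then have WU: "subgroup_covered_by G W U" using cov by blast
      then have "W \<subset> U" by (simp add: subgroup_covered_by_def)
      with max[OF cU] W have WV: "W \<subset> V" by blast
      have sW: "subgroup W G" using W sub by blast
      obtain U' where U': "U' \<in> cyclic_subgroups G" "U' \<subseteq> V" "subgroup_covered_by G W U'"
        using cyclic_upper_cover_below[OF V sW WV] by metis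
      then have aU': "adj W U'" using W by (simp add: adj_iff)
      have "U = U'"
      proof (cases "W = {\<one>}")
        case True
        then show ?thesis using only U aU' by blast
      next
        case False
        then obtain q where "Factorial_Ring.prime q" "q dvd card W"
          using nontrivial_prime_dvd[OF sW] by blast
        then obtain L where L: "L \<in> cyclic_subgroups G" "subgroup_covered_by G L W"
          using cyclic_lower_cover[of W q] W by (metis mem_Collect_eq)
        then have "adj W L" using W by (simp add: adj_iff)
        moreover have "L \<noteq> U" "L \<noteq> U'"
          using L(2) WU U'(3) by (auto simp: subgroup_covered_by_def)
        ultimately show ?thesis using deg[OF U aU', of L] by blast
      qed
      then show ?thesis using U' by simp
    qed
  qed
  obtain g where g: "g \<in> carrier G" "V = generate G {g}" "ord g = card V"
    using V by (rule cyclic_subgroupE)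
  have "z \<in> V" if "z \<in> carrier G" for z
    using S[OF cyclic_subgroupI[OF that]] generate_self[of z] by auto
  then have carr: "carrier G = generate G {g}"
    using g(2) subgroup.subset[OF sub[OF V]] by blast
  have cP: "P \<in> cyclic_subgroups G" and pP: "Factorial_Ring.prime (card P)"
    using P by (auto simp: adj_trivial_iff)
  have "r = card P" if r: "Factorial_Ring.prime r" "r dvd card V" for r
  proof -
    obtain U where "U \<in> cyclic_subgroups G" "card U = r"
      using cyclic_subgroup_of_order[OF V r(2)] by metis
    then show ?thesis using only[of U] r(1) by (simp add: adj_trivial_iff)
  qed
  then obtain k where k: "card V = card P ^ k"
    using prime_power_if_unique_prime_divisor[OF card_subgroup_pos[OF sub[OF V]] pP] by blast
  have "card P dvd card V"
    using subgroup_card_dvd[OF sub[OF cP] sub[OF V]] S[OF cP] by simp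
  then have "0 < k" using k pP by (auto intro: Nat.gr0I)
  moreover have "G \<cong> integer_mod_group (card P ^ k)"
    using iso_integer_mod_group_iff[of "card P ^ k"] carr g k pP prime_gt_0_nat by auto
  ultimately show ?thesis using pP by blast
qed

lemma adj_trivial_exists:
  assumes "H \<in> cyclic_subgroups G" "H \<noteq> {\<one>}"
  shows "\<exists>P. adj {\<one>} P"
proof -
  obtain q where "Factorial_Ring.prime q" "q dvd card H"
    using nontrivial_prime_dvd[OF cyclic_subgroup_subgroup[OF assms(1)] assms(2)] .
  then show ?thesis
    using cyclic_subgroup_of_order[OF assms(1)] by (metis adj_trivial_iff)
qed

lemma path_graph_iff:
  "path_graph (cyclic_subgroup_graph G) \<longleftrightarrow>
    (\<exists>(p::nat) k::nat. Factorial_Ring.prime p \<and> 0 < k \<and> G \<cong> integer_mod_group (p ^ k))"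
proof
  assume path: "path_graph (cyclic_subgroup_graph G)"
  note deg = path_graph_degree(1)[OF path]
  obtain E where E: "E \<in> cyclic_subgroups G" "\<And>A B. adj E A \<Longrightarrow> adj E B \<Longrightarrow> A = B"
    using path_graph_degree(2)[OF path] by (auto simp: verts_eq)
  have "cyclic_subgroups G \<noteq> {{\<one>}}"
    using path_graph_degree(3)[OF path] by (auto simp: verts_eq)
  then obtain P where P: "adj {\<one>} P"
    using adj_trivial_exists trivial_cyclic_subgroup by blast
  have "R = P" if "adj {\<one>} R" for R
  proof (rule ccontr)
    assume "R \<noteq> P"
    then have "\<exists>A B. A \<noteq> B \<and> adj E A \<and> adj E B"
      using max_degree_two_four_cycle(2)[OF _ that P _ E(1)] deg by blast
    then show False using E(2) by blast
  qed
  then show "\<exists>(p::nat) k::nat. Factorial_Ring.prime p \<and> 0 < k \<and> G \<cong> integer_mod_group (p ^ k)"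
    using max_degree_two_chain[OF _ P] deg by blast
next
  assume "\<exists>(p::nat) k::nat. Factorial_Ring.prime p \<and> 0 < k \<and> G \<cong> integer_mod_group (p ^ k)"
  then obtain p k :: nat where pk: "Factorial_Ring.prime p" "0 < k" and iso: "G \<cong> integer_mod_group (p ^ k)"
    by blast
  obtain g where g: "finite_cyclic_group G g" "ord g = p ^ k"
    using iso_integer_mod_groupE[OF iso] prime_gt_0_nat[OF pk(1)] by auto
  then show "path_graph (cyclic_subgroup_graph G)"
    by (intro finite_cyclic_group.path_graph_if_prime_power[OF g(1) pk g(2)])
qed

lemma cycle_graph_iff:
  "cycle_graph (cyclic_subgroup_graph G) \<longleftrightarrow>
    (\<exists>(p::nat) q::nat. Factorial_Ring.prime p \<and> Factorial_Ring.prime q \<and> p \<noteq> q \<and>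
      G \<cong> integer_mod_group (p * q))"
proof
  assume cycle: "cycle_graph (cyclic_subgroup_graph G)"
  obtain P Q where "P \<noteq> Q" "adj {\<one>} P" "adj {\<one>} Q"
    using cycle_graph_degree(2)[OF cycle, of "{\<one>}"] trivial_cyclic_subgroup by (auto simp: verts_eq)
  then show "\<exists>(p::nat) q::nat. Factorial_Ring.prime p \<and> Factorial_Ring.prime q \<and> p \<noteq> q \<and>
      G \<cong> integer_mod_group (p * q)"
    using max_degree_two_four_cycle(1)[of P Q] cycle_graph_degree(1)[OF cycle] by blast
next
  assume "\<exists>(p::nat) q::nat. Factorial_Ring.prime p \<and> Factorial_Ring.prime q \<and> p \<noteq> q \<and>
      G \<cong> integer_mod_group (p * q)"
  then obtain p q :: nat where pq: "Factorial_Ring.prime p" "Factorial_Ring.prime q" "p \<noteq> q"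
    and iso: "G \<cong> integer_mod_group (p * q)"
    by blast
  obtain g where g: "finite_cyclic_group G g" "ord g = p * q"
    using iso_integer_mod_groupE[OF iso] prime_gt_0_nat[OF pq(1)] prime_gt_0_nat[OF pq(2)] by auto
  then show "cycle_graph (cyclic_subgroup_graph G)"
    by (intro finite_cyclic_group.cycle_graph_if_two_primes[OF g(1) pq g(2)])
qed

end

section \<open>Groups with a nontrivial star centre\<close>

text \<open>A finite group with a subgroup \<open>H\<close> of prime order \<open>p\<close> such that the \<open>p\<close>-th power of every element
  outside \<open>H\<close> is a nontrivial element of \<open>H\<close>. Equivalently, all elements have order 1, \<open>p\<close> or
  \<open>p\<^sup>2\<close>, and \<open>H\<close> is the only subgroup of order \<open>p\<close>.\<close>

locale prime_core = finite_group +
  fixes p :: nat and H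
  assumes p: "Factorial_Ring.prime p"
    and H: "subgroup H G" and card_H: "card H = p"
    and outside: "\<And>x. x \<in> carrier G \<Longrightarrow> x \<notin> H \<Longrightarrow> x [^] p \<in> H \<and> x [^] p \<noteq> \<one>"
begin

lemma generate_H: "h \<in> H \<Longrightarrow> h \<noteq> \<one> \<Longrightarrow> generate G {h} = H"
  using prime_subgroup_generate(1)[OF H] p card_H by simp

lemma H_carrier: "h \<in> H \<Longrightarrow> h \<in> carrier G"
  by (rule subgroup.mem_carrier[OF H])

lemma H_pow: "h \<in> H \<Longrightarrow> h [^] p = \<one>"
  using subgroup_pow_card[OF H] card_H by simp

lemma H_iff: "x \<in> carrier G \<Longrightarrow> x \<in> H \<longleftrightarrow> x [^] p = \<one>"
  using H_pow outside by blast

lemma H_le_generate: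
  assumes "x \<in> carrier G" "x \<notin> H"
  shows "H \<subseteq> generate G {x}"
proof -
  have "x [^] p \<in> generate G {x}"
    by (rule subgroup_pow[OF subgroup_generate[OF assms(1)] generate_self])
  from generate_le[OF subgroup_generate[OF assms(1)] this] show ?thesis
    using generate_H outside[OF assms] by simp
qed

lemma H_central:
  assumes x: "x \<in> carrier G" and h: "h \<in> H"
  shows "h \<otimes> x = x \<otimes> h"
proof (cases "x = \<one>")
  case False
  have "h \<in> generate G {x}"
    using H_le_generate[OF x] generate_H[of x] False h by (cases "x \<in> H") auto
  then obtain k :: nat where "h = x [^] k" using x by (auto simp: generate_eq_pow)
  then show ?thesis using x by (metis nat_pow_Suc nat_pow_Suc2)
qed (use h H_carrier in simp)

lemma pow_square: "x \<in> carrier G \<Longrightarrow> x [^] (p * p) = \<one>"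
  using H_pow[of "x [^] p"] outside[of x] H_pow[of x] by (cases "x \<in> H") (simp_all flip: nat_pow_pow)

lemma ord_outside:
  assumes "x \<in> carrier G" "x \<notin> H"
  shows "ord x = p ^ 2"
proof -
  have "ord x dvd p ^ 2" using pow_square[OF assms(1)] pow_eq_id[OF assms(1)] by (simp add: power2_eq_square)
  then obtain i where i: "i \<le> 2" "ord x = p ^ i" using divides_primepow_nat[OF p] by blast
  have "\<not> ord x dvd p" using outside[OF assms] pow_eq_id[OF assms(1)] by blast
  then have "i \<noteq> 0" "i \<noteq> 1" using i(2) by (auto intro: Nat.gr0I)
  then have "i = 2" using i(1) by linarith
  then show ?thesis using i(2) by simp
qed

text \<open>By Cauchy's theorem, a further prime divisor would yield an element of that order, but all
  orders divide \<open>p\<^sup>2\<close>.\<close>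

lemma prime_dvd_order:
  assumes "Factorial_Ring.prime r" "r dvd order G"
  shows "r = p"
proof -
  obtain m where "order G = r ^ 1 * m" using assms(2) by auto
  then obtain K where K: "subgroup K G" "card K = r"
    using sylow_thm[OF assms(1) group_axioms _ fin, of 1 m] by auto
  have "K \<noteq> {\<one>}" using K(2) assms(1) by auto
  then obtain k where k: "k \<in> K" "k \<noteq> \<one>" using subgroup.one_closed[OF K(1)] by blast
  have kG: "k \<in> carrier G" using K(1) k(1) by (rule subgroup.mem_carrier)
  have "r dvd p * p"
    using prime_subgroup_generate(2)[OF K(1) _ k] assms(1) K(2) pow_square[OF kG] pow_eq_id[OF kG] by simp
  then show ?thesis
    using assms(1) p by (metis prime_dvd_multD primes_dvd_imp_eq)
qed

text \<open>Right multiplication by \<open>x\<close> permutes the right cosets of the group \<open>C\<close> generated by \<open>x\<close>. Its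
  \<open>p\<close>-th power is trivial, because \<open>x\<^sup>p\<close> is central and lies in \<open>C\<close>. As \<open>p\<close> divides the number
  of cosets, the fixed coset \<open>C\<close> is not the only one, and a fixed coset \<open>C g\<close> means that
  \<open>g x g\<^sup>-\<^sup>1\<close> lies in \<open>C\<close>.\<close>

lemma normalizing_element:
  assumes x: "x \<in> carrier G" "x \<notin> H" and ne: "carrier G \<noteq> generate G {x}"
  obtains g where "g \<in> carrier G" "g \<notin> generate G {x}" "g \<otimes> x \<otimes> inv g \<in> generate G {x}"
proof -
  let ?C = "generate G {x}"
  have C: "subgroup ?C G" using subgroup_generate[OF x(1)] .
  have CG: "?C \<subseteq> carrier G" using subgroup.subset[OF C] .
  have xC: "x \<in> ?C" by (rule generate_self)
  let ?R = "rcosets ?C" and ?f = "\<lambda>X. X #> x"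
  have finR: "finite ?R" using cosets_finite fin by (simp add: RCOSETS_def)
  have card: "card ?R * card ?C = order G" using lagrange[OF C] .
  have "card ?C < card (carrier G)" using CG ne fin by (metis psubsetI psubset_card_mono)
  then have "card ?R \<noteq> 1" using card by (auto simp: order_def)
  then obtain r where r: "Factorial_Ring.prime r" "r dvd card ?R" using prime_factor_nat by blast
  have "r dvd order G" using r(2) by (subst card[symmetric]) simp
  then have pR: "p dvd card ?R" using prime_dvd_order r by blast
  have coset: "\<exists>a\<in>carrier G. X = ?C #> a" if "X \<in> ?R" for X
    using that by (auto simp: RCOSETS_def)
  have pow: "(?f ^^ n) (?C #> a) = ?C #> (a \<otimes> x [^] n)" if "a \<in> carrier G" for a n
    using that x(1) CG by (induction n) (simp_all add: coset_mult_assoc m_assoc)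
  have per: "(?f ^^ p) X = X" if h: "X \<in> ?R" for X
  proof -
    obtain a where a: "a \<in> carrier G" "X = ?C #> a" using coset[OF h] by blast
    have xp: "x [^] p \<in> H" "x [^] p \<in> ?C" using outside[OF x] subgroup_pow[OF C xC] by auto
    have "?C #> (a \<otimes> x [^] p) = ?C #> (x [^] p \<otimes> a)" using H_central[OF a(1) xp(1)] by simp
    also have "\<dots> = (?C #> x [^] p) #> a" using CG x(1) a(1) by (simp add: coset_mult_assoc)
    also have "\<dots> = ?C #> a" using coset_join2[OF _ C xp(2)] x(1) by simp
    finally show ?thesis using pow[OF a(1)] a(2) by simp
  qed
  have fR: "?f X \<in> ?R" if "X \<in> ?R" for X
    using coset[OF that] x(1) CG by (auto simp: coset_mult_assoc rcosetsI)
  have CR: "?C \<in> ?R"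
    using subgroup.subgroup_in_rcosets[OF C group_axioms] .
  have fC: "?f ?C = ?C"
    using coset_join2[OF x(1) C xC] .
  obtain X where X: "X \<in> ?R" "?f X = X" "X \<noteq> ?C"
    using exists_second_fixed_point[OF finR fR p per pR CR fC] by blast
  obtain g where g: "g \<in> carrier G" "X = ?C #> g" using coset[OF X(1)] by blast
  have "g \<notin> ?C" using coset_join2[OF g(1) C] X(3) g(2) by blast
  moreover have "g \<otimes> x \<in> ?C #> g"
  proof -
    have "?C #> (g \<otimes> x) = ?C #> g" using X(2) g x(1) CG by (simp add: coset_mult_assoc)
    then show ?thesis using rcos_self[OF _ C, of "g \<otimes> x"] g(1) x(1) by simp
  qed
  then obtain c where c: "c \<in> ?C" "g \<otimes> x = c \<otimes> g" by (auto simp: r_coset_def)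
  then have "g \<otimes> x \<otimes> inv g \<in> ?C" using g(1) CG by (auto simp: m_assoc)
  ultimately show ?thesis using that g(1) by blast
qed

text \<open>For odd \<open>p\<close>, the element \<open>g\<close> of the preceding lemma is absorbed: \<open>g\<close> commutes with the powers of
  \<open>x\<close> up to elements of \<open>H\<close>, so a suitable power \<open>u\<close> of \<open>x\<close> satisfies \<open>(u g)\<^sup>p = 1\<close>.\<close>

lemma cyclic_if_odd:
  assumes odd: "p \<noteq> 2" and x: "x \<in> carrier G" "x \<notin> H"
  shows "carrier G = generate G {x}"
proof (rule ccontr)
  assume "carrier G \<noteq> generate G {x}"
  then obtain g where g: "g \<in> carrier G" "g \<notin> generate G {x}" "g \<otimes> x \<otimes> inv g \<in> generate G {x}"
    using normalizing_element[OF x] by blast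
  let ?C = "generate G {x}"
  have C: "subgroup ?C G" using subgroup_generate[OF x(1)] .
  have xC: "x \<in> ?C" by (rule generate_self)
  have HC: "H \<subseteq> ?C" using H_le_generate[OF x] .
  have gH: "g \<notin> H" using g(2) HC by blast
  define c where "c = g \<otimes> x \<otimes> inv g"
  \<comment> \<open>The commutator of \<open>g\<close> and \<open>x\<close>; its \<open>p\<close>-th power is trivial, so it lies in \<open>H\<close>.\<close>
  define d where "d = c \<otimes> inv x"
  have cG: "c \<in> carrier G" and dG: "d \<in> carrier G" using g(1) x(1) by (auto simp: c_def d_def)
  obtain k :: nat where k: "c = x [^] k" using g(3) x(1) by (auto simp: c_def generate_eq_pow)
  have cx: "c \<otimes> inv x = inv x \<otimes> c"
  proof -
    have "x \<otimes> c = c \<otimes> x" unfolding k using x(1) by (metis nat_pow_Suc nat_pow_Suc2)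
    then have "inv x \<otimes> (x \<otimes> c) \<otimes> inv x = inv x \<otimes> (c \<otimes> x) \<otimes> inv x" by simp
    then show ?thesis using cG x(1) by (simp add: m_assoc inv_cancel_left)
  qed
  have "c [^] p = x [^] p"
  proof -
    have "c [^] p = g \<otimes> x [^] p \<otimes> inv g" unfolding c_def using conj_pow[OF x(1) g(1)] .
    also have "\<dots> = x [^] p \<otimes> g \<otimes> inv g" using H_central[OF g(1), of "x [^] p"] outside[OF x] by simp
    finally show ?thesis using x(1) g(1) by (simp add: m_assoc)
  qed
  then have "d [^] p = \<one>"
    unfolding d_def using pow_mult_distrib[OF cx cG] x(1) by (simp add: nat_pow_inv)
  then have dH: "d \<in> H" using H_iff[OF dG] by simp
  have gx: "g \<otimes> x \<otimes> inv g = d \<otimes> x"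
    using cG x(1) by (simp add: d_def c_def[symmetric] m_assoc)
  \<comment> \<open>The exponent \<open>j\<close> is chosen such that the \<open>p\<close>-th power of \<open>x\<^sup>j\<close> cancels that of \<open>g\<close>.\<close>
  have "inv (g [^] p) \<in> generate G {x [^] p}"
    using generate_H[of "x [^] p"] outside[OF x] outside[OF g(1) gH] subgroup.m_inv_closed[OF H] by simp
  then obtain j :: nat where j: "inv (g [^] p) = (x [^] p) [^] j"
    using x(1) by (auto simp: generate_eq_pow)
  define u where "u = x [^] j"
  define e where "e = d [^] j"
  have uG: "u \<in> carrier G" using x(1) by (simp add: u_def)
  have uC: "u \<in> ?C" unfolding u_def using subgroup_pow[OF C xC] .
  have eH: "e \<in> H" unfolding e_def using subgroup_pow[OF H dH] .
  have eG: "e \<in> carrier G" using H_carrier[OF eH] .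
  have "g \<otimes> u \<otimes> inv g = e \<otimes> u"
    unfolding u_def conj_pow[OF x(1) g(1), symmetric] gx e_def
    using pow_mult_distrib[OF H_central[OF x(1) dH] dG x(1)] .
  then have "g \<otimes> u \<otimes> inv g \<otimes> g = e \<otimes> u \<otimes> g" by simp
  then have gu: "g \<otimes> u = e \<otimes> (u \<otimes> g)" using g(1) uG eG by (simp add: m_assoc)
  \<comment> \<open>Here \<open>p\<close> odd is used: \<open>p\<close> divides \<open>p (p - 1) / 2\<close>.\<close>
  have tri: "e [^] (\<Sum>i<p. i) = \<one>"
  proof -
    have "p dvd (\<Sum>i<p. i)"
    proof -
      have "2 * (\<Sum>i<p. i) = p * (p - 1)"
      proof -
        have "even (p * (p - Suc 0))" by (cases p) auto
        then show ?thesis by (simp add: Sum_Ico_nat lessThan_atLeast0)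
      qed
      then have "p dvd 2 * (\<Sum>i<p. i)" by simp
      moreover have "\<not> p dvd 2" using odd p two_is_prime_nat primes_dvd_imp_eq by blast
      ultimately show ?thesis using p prime_dvd_multD by blast
    qed
    then obtain t where "(\<Sum>i<p. i) = p * t" ..
    then show ?thesis using H_pow[OF eH] eG by (simp flip: nat_pow_pow)
  qed
  have "u [^] p = inv (g [^] p)"
    using j x(1) by (simp add: u_def nat_pow_pow mult.commute)
  then have "(u \<otimes> g) [^] p = \<one>"
    using pow_mult_twisted[OF uG g(1) eG H_central[OF uG eH] H_central[OF g(1) eH] gu, of p] tri g(1) by simp
  then have "u \<otimes> g \<in> ?C" using H_iff[of "u \<otimes> g"] uG g(1) HC by auto
  then have "inv u \<otimes> (u \<otimes> g) \<in> ?C"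
    using subgroup.m_closed[OF C] subgroup.m_inv_closed[OF C uC] by blast
  then show False using g(1,2) uG by (simp add: inv_cancel_left)
qed

end

text \<open>A group of at most eight elements satisfying the quaternion relations, with \<open>z\<close> in the role of \<open>-1\<close> and \<open>x\<close>, \<open>y\<close> in
  the roles of \<open>i\<close>, \<open>j\<close>. That the eight listed elements are distinct follows from
  \<open>z \<noteq> 1\<close>.\<close>

lemma (in group) iso_Q8I:
  assumes c: "x \<in> carrier G" "y \<in> carrier G" "z \<in> carrier G"
    and rel: "x \<otimes> x = z" "y \<otimes> y = z" "z \<otimes> z = \<one>" "y \<otimes> x = z \<otimes> (x \<otimes> y)"
    and zc: "x \<otimes> z = z \<otimes> x" "y \<otimes> z = z \<otimes> y" and z1: "z \<noteq> \<one>"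
    and gen: "carrier G \<subseteq> {\<one>, z, x, z \<otimes> x, y, z \<otimes> y, x \<otimes> y, z \<otimes> (x \<otimes> y)}"
  shows "G \<cong> Q8"
proof -
  define f :: "int_quaternion \<Rightarrow> 'a" where
    "f q = (if q = (1, 0, 0, 0) then \<one> else if q = (-1, 0, 0, 0) then z
      else if q = (0, 1, 0, 0) then x else if q = (0, -1, 0, 0) then z \<otimes> x
      else if q = (0, 0, 1, 0) then y else if q = (0, 0, -1, 0) then z \<otimes> y
      else if q = (0, 0, 0, 1) then x \<otimes> y else z \<otimes> (x \<otimes> y))" for q
  \<comment> \<open>With associativity, these oriented rules form a rewriting system with normal forms \<open>z\<^sup>a x\<^sup>b y\<^sup>c\<close>, where \<open>a\<close>, \<open>b\<close>, \<open>c\<close> are 0 or 1.\<close>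
  have rel': "x \<otimes> (x \<otimes> w) = z \<otimes> w" "y \<otimes> (y \<otimes> w) = z \<otimes> w" "z \<otimes> (z \<otimes> w) = w"
    "y \<otimes> (x \<otimes> w) = z \<otimes> (x \<otimes> (y \<otimes> w))" "x \<otimes> (z \<otimes> w) = z \<otimes> (x \<otimes> w)" "y \<otimes> (z \<otimes> w) = z \<otimes> (y \<otimes> w)"
    if "w \<in> carrier G" for w
    using that c rel zc by (simp_all flip: m_assoc)
  have hom: "f \<in> hom Q8 G"
  proof (rule homI)
    fix q assume "q \<in> carrier Q8"
    then show "f q \<in> carrier G" using c by (auto simp: Q8_def f_def)
  next
    fix q r assume "q \<in> carrier Q8" "r \<in> carrier Q8"
    then show "f (q \<otimes>\<^bsub>Q8\<^esub> r) = f q \<otimes> f r"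
      unfolding Q8_def
      by (simp, elim disjE) (simp_all add: f_def c m_assoc rel rel' zc)
  qed
  interpret Q: group Q8 by (rule group_Q8)
  interpret f: group_hom Q8 G f
    using hom by (simp add: group_hom_def group_hom_axioms_def group_Q8 group_axioms)
  have xy: "y \<otimes> x \<noteq> x \<otimes> y"
    unfolding rel(4) using c z1 by simp
  have ne: "x \<noteq> \<one>" "y \<noteq> \<one>" "z \<otimes> x \<noteq> \<one>" "z \<otimes> y \<noteq> \<one>" "x \<otimes> y \<noteq> \<one>" "z \<otimes> (x \<otimes> y) \<noteq> \<one>"
  proof -
    show x1: "x \<noteq> \<one>" and "y \<noteq> \<one>" using xy c by auto
    show "z \<otimes> x \<noteq> \<one>"
    proof
      assume "z \<otimes> x = \<one>"
      then have "x = z" using rel'(3)[OF c(1)] c(3) by simp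
      then show False using rel(1,3) z1 by simp
    qed
    show "z \<otimes> y \<noteq> \<one>"
    proof
      assume "z \<otimes> y = \<one>"
      then have "y = z" using rel'(3)[OF c(2)] c(3) by simp
      then show False using rel(2,3) z1 by simp
    qed
    show "x \<otimes> y \<noteq> \<one>"
    proof
      assume *: "x \<otimes> y = \<one>"
      then have "z \<otimes> y = x" using rel'(1)[OF c(2)] c(1) by simp
      then have "y \<otimes> x = \<one>" using rel'(6)[OF c(2)] rel(2,3) by metis
      then show False using xy * by simp
    qed
    show "z \<otimes> (x \<otimes> y) \<noteq> \<one>"
    proof
      assume *: "z \<otimes> (x \<otimes> y) = \<one>"
      then have "x \<otimes> y = z" using rel'(3)[of "x \<otimes> y"] c by simp
      then have "z \<otimes> y = z \<otimes> x" using rel'(1)[OF c(2)] zc(1) by simp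
      then have "y = x" using c by simp
      then show False using xy by simp
    qed
  qed
  have "kernel Q8 G f = {\<one>\<^bsub>Q8\<^esub>}"
    using z1 ne by (auto simp: kernel_def Q8_def f_def)
  then have "inj_on f (carrier Q8)" by (rule f.trivial_ker_imp_inj)
  moreover have "f ` carrier Q8 = carrier G"
  proof
    have "f ` carrier Q8 = {\<one>, z, x, z \<otimes> x, y, z \<otimes> y, x \<otimes> y, z \<otimes> (x \<otimes> y)}"
      by (simp add: Q8_def f_def insert_commute)
    then show "carrier G \<subseteq> f ` carrier Q8" using gen by simp
  qed (use f.hom_closed in blast)
  ultimately have "f \<in> iso Q8 G" using hom by (simp add: iso_def bij_betw_def)
  then show ?thesis using Q.iso_sym by (auto simp: is_iso_def)
qed

context prime_core
begin

text \<open>All elements outside \<open>H = {1, z}\<close> square to \<open>z\<close>. If \<open>u\<close>, \<open>v\<close> and \<open>u v\<close> are outside \<open>H\<close>, expanding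
  \<open>(u v)\<^sup>2 = z\<close> gives \<open>v u = z u v\<close>. With \<open>y\<close> outside the group generated by \<open>x\<close>, an element
  that anticommutes in this sense with \<open>x\<close> and with \<open>y\<close> commutes with \<open>x y\<close>, which bounds the
  group to eight elements.\<close>

lemma Q8_if_two_not_cyclic:
  assumes two: "p = 2" and x: "x \<in> carrier G" "x \<notin> H" and ne: "carrier G \<noteq> generate G {x}"
  shows "G \<cong> Q8"
proof -
  have sq: "w [^] p = w \<otimes> w" if "w \<in> carrier G" for w
    using that by (simp add: two numeral_2_eq_2)
  note H1 = subgroup.one_closed[OF H] and Hm = subgroup.m_closed[OF H] and Hi = subgroup.m_inv_closed[OF H]
  have "H \<noteq> {\<one>}" using card_H two by auto
  then obtain z where z: "z \<in> H" "z \<noteq> \<one>" using H1 by blast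
  have zG: "z \<in> carrier G" using H_carrier z(1) .
  have "card {\<one>, z} = card H" using z(2) card_H two by simp
  then have Hz: "H = {\<one>, z}"
    using card_subset_eq[OF finite_subgroup[OF H], of "{\<one>, z}"] H1 z(1) by auto
  have out: "w \<otimes> w = z" if "w \<in> carrier G" "w \<notin> H" for w
    using outside[OF that] sq[OF that(1)] Hz by auto
  have zz: "z \<otimes> z = \<one>" using H_pow[OF z(1)] sq[OF zG] by simp
  have zc: "w \<otimes> z = z \<otimes> w" if "w \<in> carrier G" for w
    using H_central[OF that z(1)] by simp
  have zcancel: "z \<otimes> (z \<otimes> w) = w" if "w \<in> carrier G" for w
    using zz zG that by (simp flip: m_assoc)
  have zne: "z \<otimes> w \<noteq> w" if "w \<in> carrier G" for w
    using z(2) zG that by simp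
  have anti: "v \<otimes> u = z \<otimes> (u \<otimes> v)"
    if u: "u \<in> carrier G" "u \<notin> H" and v: "v \<in> carrier G" "v \<notin> H" and uv: "u \<otimes> v \<notin> H" for u v
  proof -
    have "z \<otimes> (u \<otimes> v) = u \<otimes> z \<otimes> v" using zc[OF u(1)] u v zG by (simp add: m_assoc)
    also have "\<dots> = u \<otimes> ((u \<otimes> v) \<otimes> (u \<otimes> v)) \<otimes> v" using out[OF _ uv] u v by simp
    also have "\<dots> = (u \<otimes> u) \<otimes> ((v \<otimes> u) \<otimes> (v \<otimes> v))" using u v by (simp add: m_assoc)
    also have "\<dots> = z \<otimes> ((v \<otimes> u) \<otimes> z)" using out[OF u] out[OF v] by simp
    also have "\<dots> = v \<otimes> u" using zc[of "v \<otimes> u"] zcancel[of "v \<otimes> u"] u v by simp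
    finally show ?thesis by simp
  qed
  let ?C = "generate G {x}"
  have C: "subgroup ?C G" using subgroup_generate[OF x(1)] .
  have xC: "x \<in> ?C" by (rule generate_self)
  have HC: "H \<subseteq> ?C" using H_le_generate[OF x] .
  obtain y where y: "y \<in> carrier G" "y \<notin> ?C"
    using ne subgroup.subset[OF C] by blast
  have yH: "y \<notin> H" using y(2) HC by blast
  have absorb: "w = u \<or> w = z \<otimes> u" if u: "u \<in> carrier G" "u \<notin> H" and w: "w \<in> carrier G" "u \<otimes> w \<in> H" for u w
  proof -
    have "u \<otimes> (u \<otimes> w) = z \<otimes> w" using out[OF u] u w by (simp flip: m_assoc)
    then have "w = z \<otimes> (u \<otimes> (u \<otimes> w))" using zcancel[OF w(1)] by simp
    moreover have "u \<otimes> w = \<one> \<or> u \<otimes> w = z" using w(2) Hz by simp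
    ultimately show ?thesis using zc[OF u(1)] zcancel[OF u(1)] u(1) by auto
  qed
  have xyH: "x \<otimes> y \<notin> H"
  proof
    assume "x \<otimes> y \<in> H"
    then have "y = x \<or> y = z \<otimes> x" using absorb[OF x y(1)] by simp
    then show False using y(2) xC HC z(1) subgroup.m_closed[OF C] by auto
  qed
  have yx: "y \<otimes> x = z \<otimes> (x \<otimes> y)" using anti[OF x y(1) yH xyH] .
  have "w \<in> {\<one>, z, x, z \<otimes> x, y, z \<otimes> y, x \<otimes> y, z \<otimes> (x \<otimes> y)}" if w: "w \<in> carrier G" for w
  proof (cases "w \<in> H \<or> x \<otimes> w \<in> H \<or> y \<otimes> w \<in> H")
    case True
    then show ?thesis using Hz absorb[OF x w] absorb[OF y(1) yH w] by auto
  next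
    case False
    then have xw: "w \<otimes> x = z \<otimes> (x \<otimes> w)" and yw: "w \<otimes> y = z \<otimes> (y \<otimes> w)"
      using anti[OF x w] anti[OF y(1) yH w] by auto
    have "w \<otimes> (x \<otimes> y) = (w \<otimes> x) \<otimes> y" using w x y by (simp add: m_assoc)
    also have "\<dots> = z \<otimes> (x \<otimes> (w \<otimes> y))" unfolding xw using w x y zG by (simp add: m_assoc)
    also have "\<dots> = z \<otimes> (z \<otimes> (x \<otimes> (y \<otimes> w)))"
    proof -
      have "x \<otimes> (z \<otimes> (y \<otimes> w)) = z \<otimes> (x \<otimes> (y \<otimes> w))"
        using zc[OF x(1)] w x y zG by (simp flip: m_assoc)
      then show ?thesis unfolding yw by simp
    qed
    also have "\<dots> = (x \<otimes> y) \<otimes> w" using w x y zcancel by (simp add: m_assoc)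
    finally have "w \<otimes> (x \<otimes> y) = (x \<otimes> y) \<otimes> w" .
    then have "(x \<otimes> y) \<otimes> w \<in> H"
      using anti[of "x \<otimes> y" w] xyH w False zne[of "(x \<otimes> y) \<otimes> w"] x y by auto
    then show ?thesis using absorb[of "x \<otimes> y" w] xyH w x y by auto
  qed
  then have gen: "carrier G \<subseteq> {\<one>, z, x, z \<otimes> x, y, z \<otimes> y, x \<otimes> y, z \<otimes> (x \<otimes> y)}" by blast
  show ?thesis
    by (rule iso_Q8I[OF x(1) y(1) zG out[OF x] out[OF y(1) yH] zz yx zc[OF x(1)] zc[OF y(1)] z(2) gen])
qed

lemma classification:
  "carrier G = H \<or> G \<cong> integer_mod_group (p ^ 2) \<or> G \<cong> Q8"
proof (cases "carrier G = H")
  case False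
  then obtain x where x: "x \<in> carrier G" "x \<notin> H" using subgroup.subset[OF H] by blast
  show ?thesis
  proof (cases "carrier G = generate G {x}")
    case True
    then have "G \<cong> integer_mod_group (p ^ 2)"
      using iso_integer_mod_group_iff[of "p ^ 2"] ord_outside[OF x] x(1) prime_gt_0_nat[OF p] by auto
    then show ?thesis by simp
  next
    case False
    then show ?thesis using cyclic_if_odd[OF _ x] Q8_if_two_not_cyclic[OF _ x] by blast
  qed
qed simp

end

section \<open>Stars\<close>

context finite_group
begin

lemma star_graph_iff_centre:
  "star_graph (cyclic_subgroup_graph G) \<longleftrightarrow> (\<exists>c\<in>cyclic_subgroups G. \<forall>U W. adj U W \<longleftrightarrow>
    U \<in> cyclic_subgroups G \<and> W \<in> cyclic_subgroups G \<and> U \<noteq> W \<and> (U = c \<or> W = c))"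
proof
  assume "star_graph (cyclic_subgroup_graph G)"
  then obtain A B where AB: "cyclic_subgroups G = A \<union> B" "A \<inter> B = {}" "card A = 1"
    and arcs: "arcs_ends (cyclic_subgroup_graph G) = A \<times> B \<union> B \<times> A"
    unfolding star_graph_def complete_bipartite_digraph_def verts_eq by blast
  obtain c where "A = {c}" using AB(3) card_1_singletonE by blast
  then show "\<exists>c\<in>cyclic_subgroups G. \<forall>U W. adj U W \<longleftrightarrow>
    U \<in> cyclic_subgroups G \<and> W \<in> cyclic_subgroups G \<and> U \<noteq> W \<and> (U = c \<or> W = c)"
    using AB(1,2) unfolding arcs by (intro bexI[of _ c]) auto
next
  assume "\<exists>c\<in>cyclic_subgroups G. \<forall>U W. adj U W \<longleftrightarrow>
    U \<in> cyclic_subgroups G \<and> W \<in> cyclic_subgroups G \<and> U \<noteq> W \<and> (U = c \<or> W = c)"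
  then obtain c where c: "c \<in> cyclic_subgroups G" "\<And>U W. adj U W \<longleftrightarrow>
    U \<in> cyclic_subgroups G \<and> W \<in> cyclic_subgroups G \<and> U \<noteq> W \<and> (U = c \<or> W = c)" by blast
  let ?B = "cyclic_subgroups G - {c}"
  have arcs: "arcs_ends (cyclic_subgroup_graph G) = {c} \<times> ?B \<union> ?B \<times> {c}"
  proof (rule Set.set_eqI)
    fix e :: "'a set \<times> 'a set"
    obtain U W where "e = (U, W)" by (cases e)
    then show "e \<in> arcs_ends (cyclic_subgroup_graph G) \<longleftrightarrow> e \<in> {c} \<times> ?B \<union> ?B \<times> {c}"
      using c(1) c(2)[of U W] by auto
  qed
  have "cyclic_subgroups G = {c} \<union> ?B" using c(1) by blast
  then have "complete_bipartite_digraph 1 (card ?B) (cyclic_subgroup_graph G)"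
    unfolding complete_bipartite_digraph_def verts_eq
    using graph_cyclic_subgroup_graph[OF fin] arcs
    by (intro conjI exI[of _ "{c}"] exI[of _ ?B]) simp_all
  then show "star_graph (cyclic_subgroup_graph G)"
    unfolding star_graph_def by blast
qed

lemma star_graph_if_prime_orders:
  assumes "\<forall>x\<in>carrier G. x \<noteq> \<one> \<longrightarrow> Factorial_Ring.prime (ord x)"
  shows "star_graph (cyclic_subgroup_graph G)"
proof -
  have prime: "Factorial_Ring.prime (card U)" if h: "U \<in> cyclic_subgroups G" "U \<noteq> {\<one>}" for U
  proof -
    obtain x where x: "x \<in> carrier G" "U = generate G {x}" "ord x = card U"
      using h(1) by (rule cyclic_subgroupE)
    moreover have "x \<noteq> \<one>" using x(2) h(2) generate_one by auto
    ultimately show ?thesis using assms by metis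
  qed
  have ncov: "\<not> subgroup_covered_by G U W" if U: "U \<in> cyclic_subgroups G" "U \<noteq> {\<one>}"
    and W: "W \<in> cyclic_subgroups G" "W \<noteq> {\<one>}" for U W
  proof
    assume "subgroup_covered_by G U W"
    then obtain q where "Factorial_Ring.prime q" "card W = q * card U"
      using covered_card[OF W(1) cyclic_subgroup_subgroup[OF U(1)]] by metis
    then show False using prime[OF U] prime[OF W] prime_product by (metis not_prime_1)
  qed
  show ?thesis
    unfolding star_graph_iff_centre
  proof (intro bexI[OF _ trivial_cyclic_subgroup] allI)
    fix U W
    show "adj U W \<longleftrightarrow> U \<in> cyclic_subgroups G \<and> W \<in> cyclic_subgroups G \<and> U \<noteq> W \<and> (U = {\<one>} \<or> W = {\<one>})"
      (is "_ \<longleftrightarrow> ?R")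
    proof
      assume "adj U W"
      then show ?R using ncov[of U W] ncov[of W U] by (auto simp: adj_iff subgroup_covered_by_def)
    next
      assume R: ?R
      then show "adj U W"
        using prime[of U] prime[of W] adj_trivial_iff[of U] adj_trivial_iff[of W] adj_sym[of "{\<one>}" U] by metis
    qed
  qed
qed

text \<open>The centre is \<open>H\<close>: the other vertices are the trivial subgroup and subgroups of order \<open>p\<^sup>2\<close>
  containing \<open>H\<close>, and no two of them are adjacent.\<close>

lemma (in prime_core) star_graph_if_prime_core:
  "star_graph (cyclic_subgroup_graph G)"
  unfolding star_graph_iff_centre
proof (intro bexI allI)
  obtain h where "h \<in> H" "h \<noteq> \<one>"
    using card_H p subgroup.one_closed[OF H] subgroup_trivial_iff[OF H] by (metis not_prime_1 singletonI subsetI subset_antisym subset_singleton_iff empty_iff)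
  then show cH: "H \<in> cyclic_subgroups G"
    using generate_H cyclic_subgroupI[OF H_carrier] by metis
  have H1: "H \<noteq> {\<one>}" using card_H p by auto
  have other: "card U = p ^ 2 \<and> H \<subseteq> U" if U: "U \<in> cyclic_subgroups G" "U \<noteq> {\<one>}" "U \<noteq> H" for U
  proof -
    obtain x where x: "x \<in> carrier G" "U = generate G {x}" "ord x = card U"
      using U(1) by (rule cyclic_subgroupE)
    have "x \<noteq> \<one>" using x(2) U(2) generate_one by auto
    then have "x \<notin> H" using generate_H x(2) U(3) by blast
    then show ?thesis using ord_outside[OF x(1)] H_le_generate[OF x(1)] x by simp
  qed
  have ncov: "\<not> subgroup_covered_by G U W" if U: "U \<in> cyclic_subgroups G" "U \<noteq> H"
    and W: "W \<in> cyclic_subgroups G" "W \<noteq> H" for U W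
  proof
    assume cov: "subgroup_covered_by G U W"
    have sW: "subgroup W G" using cyclic_subgroup_subgroup[OF W(1)] .
    have "U \<subset> W" using cov by (simp add: subgroup_covered_by_def)
    moreover have "\<one> \<in> U" using subgroup.one_closed[OF cyclic_subgroup_subgroup[OF U(1)]] .
    ultimately have "W \<noteq> {\<one>}" by blast
    then have cW: "card W = p ^ 2" "H \<subset> W" using other[OF W(1)] W(2) by auto
    show False
    proof (cases "U = {\<one>}")
      case True
      have "{\<one>} \<subset> H" using H1 subgroup.one_closed[OF H] by blast
      then show False using cov True cW(2) H unfolding subgroup_covered_by_def by blast
    next
      case False
      then have "card U = p ^ 2" using other[OF U(1)] U(2) by simp
      then show False
        using cW(1) \<open>U \<subset> W\<close> finite_subgroup[OF sW] by (metis psubset_card_mono less_irrefl)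
    qed
  qed
  have adjH: "adj H U" if U: "U \<in> cyclic_subgroups G" "U \<noteq> H" for U
  proof (cases "U = {\<one>}")
    case True
    then show ?thesis using adj_sym adj_trivial_iff[of H] cH card_H p by simp
  next
    case False
    then have "subgroup_covered_by G H U"
      using covered_if_prime_index[OF H cyclic_subgroup_subgroup[OF U(1)] _ _ p] other[OF U(1) False U(2)] card_H
      by (simp add: power2_eq_square)
    then show ?thesis using cH U(1) by (simp add: adj_iff)
  qed
  fix U W
  show "adj U W \<longleftrightarrow> U \<in> cyclic_subgroups G \<and> W \<in> cyclic_subgroups G \<and> U \<noteq> W \<and> (U = H \<or> W = H)"
    (is "_ \<longleftrightarrow> ?R")
  proof
    assume "adj U W"
    then show ?R using ncov[of U W] ncov[of W U] by (auto simp: adj_iff subgroup_covered_by_def)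
  next
    assume ?R
    then show "adj U W" using adjH[of W] adj_sym[OF adjH[of U]] by auto
  qed
qed

text \<open>The centre \<open>c\<close> is adjacent to the trivial subgroup, so it has prime order. For \<open>x\<close> outside \<open>c\<close>,
  the group generated by \<open>x\<close> covers \<open>c\<close>, and its proper nontrivial subgroup generated by
  \<open>x\<^sup>p\<close> with \<open>p = card c\<close> can only be \<open>c\<close>.\<close>

lemma prime_core_if_nontrivial_centre:
  assumes c: "c \<in> cyclic_subgroups G" "c \<noteq> {\<one>}"
    and star: "\<And>U W. adj U W \<longleftrightarrow>
      U \<in> cyclic_subgroups G \<and> W \<in> cyclic_subgroups G \<and> U \<noteq> W \<and> (U = c \<or> W = c)"
  shows "prime_core G (card c) c"
proof -
  have sc: "subgroup c G" using cyclic_subgroup_subgroup[OF c(1)] .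
  have adj1: "adj {\<one>} c" unfolding star using c trivial_cyclic_subgroup by blast
  then have pc: "Factorial_Ring.prime (card c)" by (simp add: adj_trivial_iff)
  have "\<not> c \<subset> {\<one>}" using subgroup.one_closed[OF sc] by blast
  then have cov1: "subgroup_covered_by G {\<one>} c"
    using adj1 unfolding adj_iff subgroup_covered_by_def by blast
  have cover: "subgroup_covered_by G c U" if U: "U \<in> cyclic_subgroups G" "U \<noteq> {\<one>}" "U \<noteq> c" for U
  proof -
    have sU: "subgroup U G" using cyclic_subgroup_subgroup[OF U(1)] .
    have "adj c U" unfolding star using c U by blast
    moreover have "\<not> subgroup_covered_by G U c"
    proof
      assume "subgroup_covered_by G U c"
      then have "U \<subset> c" by (simp add: subgroup_covered_by_def)
      moreover have "{\<one>} \<subset> U" using subgroup.one_closed[OF sU] U(2) by blast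
      ultimately show False using cov1 sU unfolding subgroup_covered_by_def by blast
    qed
    ultimately show ?thesis unfolding adj_iff by blast
  qed
  have "x [^] card c \<in> c \<and> x [^] card c \<noteq> \<one>" if x: "x \<in> carrier G" "x \<notin> c" for x
  proof -
    let ?p = "card c" and ?V = "generate G {x}"
    note sV = subgroup_generate[OF x(1)]
    have V: "?V \<in> cyclic_subgroups G" "?V \<noteq> {\<one>}" "?V \<noteq> c"
      using cyclic_subgroupI[OF x(1)] generate_self[of x] x(2) subgroup.one_closed[OF sc] by auto
    have cV: "c \<subset> ?V" and noK: "\<And>K. subgroup K G \<Longrightarrow> c \<subset> K \<Longrightarrow> K \<subset> ?V \<Longrightarrow> False"
      using cover[OF V] by (auto simp: subgroup_covered_by_def)
    have ord: "ord x = card ?V" using generate_pow_card[OF x(1)] .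
    have dvd: "?p dvd ord x" using subgroup_card_dvd[OF sc sV] cV ord by auto
    have lt: "?p < ord x" using psubset_card_mono[OF finite_subgroup[OF sV] cV] ord by simp
    have p1: "1 < ?p" using pc prime_gt_1_nat by blast
    let ?y = "x [^] ?p"
    have yG: "?y \<in> carrier G" using x(1) by simp
    have yV: "?y \<in> ?V" by (rule subgroup_pow[OF sV generate_self])
    have y1: "?y \<noteq> \<one>"
      using pow_eq_id[OF x(1)] lt p1 nat_dvd_not_less by (metis zero_less_one less_trans)
    have ordy: "ord ?y = ord x div ?p" using ord_pow[OF x(1) dvd] p1 by simp
    have "ord ?y < ord x" using ordy p1 ord_pos[OF x(1)] by simp
    then have "card (generate G {?y}) < card ?V" using generate_pow_card[OF yG] ord by simp
    moreover have "generate G {?y} \<subseteq> ?V" using generate_le[OF sV yV] .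
    ultimately have "generate G {?y} \<subset> ?V" by auto
    moreover have "generate G {?y} \<noteq> {\<one>}" using generate_self[of ?y] y1 by auto
    ultimately have "generate G {?y} = c"
      using cover[OF cyclic_subgroupI[OF yG]] noK[OF subgroup_generate[OF yG]]
      by (auto simp: subgroup_covered_by_def)
    then show ?thesis using y1 generate_self[of ?y] by auto
  qed
  then show ?thesis
    using finite_group_axioms sc pc by (simp add: prime_core_def prime_core_axioms_def)
qed

text \<open>The six elements of the quaternion group other than \<open>1\<close> and \<open>-1\<close> square to \<open>-1\<close>.\<close>

lemma prime_core_if_Q8:
  assumes "G \<cong> Q8"
  shows "\<exists>H. prime_core G 2 H"
proof -
  have "Q8 \<cong> G" using iso_sym[OF assms] .
  then obtain f where f: "f \<in> iso Q8 G" by (auto simp: is_iso_def)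
  then interpret f: group_hom Q8 G f
    by (simp add: group_hom_def group_hom_axioms_def iso_def group_Q8 group_axioms)
  have im: "f ` carrier Q8 = carrier G" and inj: "inj_on f (carrier Q8)"
    using f by (auto simp: iso_def bij_betw_def)
  let ?e = "(1, 0, 0, 0) :: int_quaternion" and ?m = "(-1, 0, 0, 0) :: int_quaternion"
  have mem: "?e \<in> carrier Q8" "?m \<in> carrier Q8" by (simp_all add: Q8_def)
  have f1: "f ?e = \<one>" using f.hom_one by (simp add: Q8_def)
  have fm: "f ?m \<noteq> \<one>" using inj_onD[OF inj _ mem(2,1)] f1 by auto
  have mult: "f (quaternion_mult a b) = f a \<otimes> f b" if "a \<in> carrier Q8" "b \<in> carrier Q8" for a b
    using f.hom_mult[OF that] by (simp add: Q8_def)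
  have mm: "f ?m \<otimes> f ?m = \<one>" using mult[OF mem(2,2)] f1 by simp
  let ?H = "{\<one>, f ?m}"
  have mG: "f ?m \<in> carrier G" using mem(2) by simp
  have "inv (f ?m) = f ?m" using inv_equality[OF mm mG mG] .
  then have sH: "subgroup ?H G"
    using mm mG by (intro subgroupI) auto
  have "x [^] (2::nat) \<in> ?H \<and> x [^] (2::nat) \<noteq> \<one>" if x: "x \<in> carrier G" "x \<notin> ?H" for x
  proof -
    obtain a where a: "a \<in> carrier Q8" "x = f a" using im x(1) by blast
    then have "a \<noteq> ?e" "a \<noteq> ?m" using x(2) f1 by auto
    then have "quaternion_mult a a = ?m" using a(1) by (auto simp: Q8_def)
    then have "x \<otimes> x = f ?m" using mult[OF a(1,1)] a(2) by simp
    then show ?thesis using fm x(1) by (simp add: numeral_2_eq_2)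
  qed
  then have "prime_core G 2 ?H"
    using finite_group_axioms sH fm by (auto simp: prime_core_def prime_core_axioms_def)
  then show ?thesis by blast
qed

lemma prime_core_if_prime_square:
  assumes p: "Factorial_Ring.prime p" and iso: "G \<cong> integer_mod_group (p ^ 2)"
  shows "\<exists>H. prime_core G p H"
proof -
  obtain g where "finite_cyclic_group G g" and o: "ord g = p ^ 2"
    using iso_integer_mod_groupE[OF iso] prime_gt_0_nat[OF p] by auto
  then interpret C: finite_cyclic_group G g by simp
  have pd: "p dvd ord g" using o by (simp add: power2_eq_square)
  have sub: "C.sub p = {y \<in> carrier G. y [^] p = \<one>}"
    unfolding C.sub_def generate_pow_roots(1)[OF C.gen(1) pd] C.gen(2)[symmetric] ..
  have pw: "x [^] (p * p) = \<one>" if "x \<in> carrier G" for x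
    using pow_order_eq_1[OF that] generate_pow_card[OF C.gen(1)] o C.gen(2)
    by (simp add: order_def power2_eq_square)
  have "x [^] p \<in> C.sub p \<and> x [^] p \<noteq> \<one>" if x: "x \<in> carrier G" "x \<notin> C.sub p" for x
    using x pw[OF x(1)] unfolding sub by (simp add: nat_pow_pow)
  then have "prime_core G p (C.sub p)"
    using finite_group_axioms C.sub_subgroup C.card_sub[OF pd] p
    by (simp add: prime_core_def prime_core_axioms_def)
  then show ?thesis by blast
qed

lemma star_graph_iff:
  "star_graph (cyclic_subgroup_graph G) \<longleftrightarrow>
    (\<exists>p::nat. Factorial_Ring.prime p \<and> G \<cong> integer_mod_group (p ^ 2)) \<or> G \<cong> Q8 \<or>
    (\<forall>x\<in>carrier G. x \<noteq> \<one> \<longrightarrow> Factorial_Ring.prime (ord x))"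
proof
  assume "star_graph (cyclic_subgroup_graph G)"
  then obtain c where c: "c \<in> cyclic_subgroups G" and star: "\<And>U W. adj U W \<longleftrightarrow>
      U \<in> cyclic_subgroups G \<and> W \<in> cyclic_subgroups G \<and> U \<noteq> W \<and> (U = c \<or> W = c)"
    unfolding star_graph_iff_centre by blast
  show "(\<exists>p::nat. Factorial_Ring.prime p \<and> G \<cong> integer_mod_group (p ^ 2)) \<or> G \<cong> Q8 \<or>
    (\<forall>x\<in>carrier G. x \<noteq> \<one> \<longrightarrow> Factorial_Ring.prime (ord x))"
  proof (cases "c = {\<one>}")
    case True
    have "Factorial_Ring.prime (ord x)" if x: "x \<in> carrier G" "x \<noteq> \<one>" for x
    proof -
      have "generate G {x} \<noteq> {\<one>}" using generate_self[of x] x(2) by auto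
      then have "adj {\<one>} (generate G {x})"
        using star[of "{\<one>}" "generate G {x}"] True c cyclic_subgroupI[OF x(1)] by auto
      then show ?thesis using generate_pow_card[OF x(1)] by (simp add: adj_trivial_iff)
    qed
    then show ?thesis by blast
  next
    case False
    interpret prime_core G "card c" c
      using prime_core_if_nontrivial_centre[OF c False star] .
    have "Factorial_Ring.prime (ord x)" if "carrier G = c" "x \<in> carrier G" "x \<noteq> \<one>" for x
      using prime_subgroup_generate(2)[OF H p, of x] that p by simp
    then show ?thesis using classification p by blast
  qed
next
  assume "(\<exists>p::nat. Factorial_Ring.prime p \<and> G \<cong> integer_mod_group (p ^ 2)) \<or> G \<cong> Q8 \<or>
    (\<forall>x\<in>carrier G. x \<noteq> \<one> \<longrightarrow> Factorial_Ring.prime (ord x))"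
  moreover have "star_graph (cyclic_subgroup_graph G)" if "prime_core G p H" for p H
    using that by (rule prime_core.star_graph_if_prime_core)
  ultimately show "star_graph (cyclic_subgroup_graph G)"
    using prime_core_if_prime_square prime_core_if_Q8 star_graph_if_prime_orders by metis
qed

end

section \<open>The characterizations\<close>

theorem theorem2p4:
  fixes G :: "('a, 'b) monoid_scheme"
  assumes "group G" and "finite (carrier G)"
  shows
    "(Digraph_Component.connected (cyclic_subgroup_graph G) \<and>
      (complete_graph (cyclic_subgroup_graph G) \<longleftrightarrow>
        trivial_group G \<or> (\<exists>p::nat. Factorial_Ring.prime p \<and> G \<cong> integer_mod_group p))) \<and>
     (path_graph (cyclic_subgroup_graph G) \<longleftrightarrow>
        (\<exists>(p::nat) k::nat. Factorial_Ring.prime p \<and> 0 < k \<and> G \<cong> integer_mod_group (p ^ k))) \<and>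
     (cycle_graph (cyclic_subgroup_graph G) \<longleftrightarrow>
        (\<exists>(p::nat) q::nat. Factorial_Ring.prime p \<and> Factorial_Ring.prime q \<and> p \<noteq> q \<and>
          G \<cong> integer_mod_group (p * q))) \<and>
     (star_graph (cyclic_subgroup_graph G) \<longleftrightarrow>
        (\<exists>p::nat. Factorial_Ring.prime p \<and> G \<cong> integer_mod_group (p ^ 2)) \<or>
        G \<cong> Q8 \<or>
        (\<forall>x \<in> carrier G. x \<noteq> \<one>\<^bsub>G\<^esub> \<longrightarrow> Factorial_Ring.prime (group.ord G x)))"
proof -
  interpret finite_group G
    using assms by (simp add: finite_group_def finite_group_axioms_def)
  show ?thesis
    using connected_cyclic_subgroup_graph complete_graph_iff path_graph_iff cycle_graph_iff
      star_graph_iff by blast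
qed

end
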